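(* Let $n\geq 6$ be an integer such that $p=(2n-1)(2n+1)$, $q=(2n-1)(2n+3)$ and $r=(2n+1)(2n+3)$ are square-free integers, and let $K=\mathbb{Q}(\sqrt{p},\sqrt{q})$. If $\alpha\in\mathcal{O}_K^{+}$ is indecomposable in $\mathcal{O}_K$, then $\min_{\delta\in\mathcal{O}_K^{\vee,+}}\mathrm{Tr}(\alpha\delta)\leq 2$.
   Context: $\mathcal{O}_K$ is the ring of integers of $K$; $\mathcal{O}_K^{+}$ is the set of totally positive elements of $\mathcal{O}_K$. An element $\alpha\in\mathcal{O}_K^{+}$ is indecomposable if it cannot be written as $\beta+\gamma$ with $\beta,\gamma\in\mathcal{O}_K^{+}$. The codifferent is $\mathcal{O}_K^{\vee}=\{\delta\in K:\mathrm{Tr}(\alpha\delta)\in\mathbb{Z}\text{ for all }\alpha\in\mathcal{O}_K\}$, and $\mathcal{O}_K^{\vee,+}$ is the set of its totally positive elements; $\mathrm{Tr}$ is the trace $K\to\mathbb{Q}$. *)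

theory Defs
  imports
    Complex_Main
    "HOL-Library.FuncSet"
    "HOL-Computational_Algebra.Polynomial"
    "HOL-Computational_Algebra.Squarefree"
begin

text \<open>Number fields are represented as subfields of an ambient field type.\<close>

definition subfield_of_type :: "'a::field set \<Rightarrow> bool" where
  "subfield_of_type F \<longleftrightarrow>
     0 \<in> F \<and> 1 \<in> F \<and>
     (\<forall>x\<in>F. \<forall>y\<in>F. x + y \<in> F \<and> x * y \<in> F) \<and>
     (\<forall>x\<in>F. - x \<in> F \<and> inverse x \<in> F)"

text \<open>The field \<open>\<rat>(S)\<close>. In characteristic zero every subfield contains \<open>\<rat>\<close>, so the rationals
  need not be mentioned.\<close>

definition rat_adjoin :: "'a::field_char_0 set \<Rightarrow> 'a set" where
  "rat_adjoin S = \<Inter>{F. subfield_of_type F \<and> S \<subseteq> F}"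

text \<open>Field embeddings of \<open>K\<close> into another field type. Extensionality makes two embeddings equal
  as soon as they agree on \<open>K\<close>, so that a sum over this set counts every embedding once.\<close>

definition field_embeddings :: "'a::field set \<Rightarrow> ('a \<Rightarrow> 'b::field) set" where
  "field_embeddings K =
     {\<sigma> \<in> extensional K. \<sigma> 1 = 1 \<and>
        (\<forall>x\<in>K. \<forall>y\<in>K. \<sigma> (x + y) = \<sigma> x + \<sigma> y \<and> \<sigma> (x * y) = \<sigma> x * \<sigma> y)}"

text \<open>The trace \<open>K \<rightarrow> \<rat>\<close>: the sum of the images under all complex embeddings, which is a
  rational number for every element of a number field \<open>K\<close>.\<close>

definition field_trace :: "'a::field_char_0 set \<Rightarrow> 'a \<Rightarrow> rat" where
  "field_trace K x = (THE t. of_rat t = (\<Sum>\<sigma>\<in>field_embeddings K. \<sigma> x :: complex))"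

definition totally_positive :: "'a::field_char_0 set \<Rightarrow> 'a \<Rightarrow> bool" where
  "totally_positive K x \<longleftrightarrow> (\<forall>\<sigma>\<in>field_embeddings K. (0::real) < \<sigma> x)"

definition ring_of_integers :: "'a::field_char_0 set \<Rightarrow> 'a set" where
  "ring_of_integers K = {x \<in> K. algebraic_int x}"

definition pos_integers :: "'a::field_char_0 set \<Rightarrow> 'a set" where
  "pos_integers K = {x \<in> ring_of_integers K. totally_positive K x}"

definition indecomposable :: "'a::field_char_0 set \<Rightarrow> 'a \<Rightarrow> bool" where
  "indecomposable K \<alpha> \<longleftrightarrow>
     \<alpha> \<in> pos_integers K \<and> \<not> (\<exists>\<beta>\<in>pos_integers K. \<exists>\<gamma>\<in>pos_integers K. \<alpha> = \<beta> + \<gamma>)"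

definition codifferent :: "'a::field_char_0 set \<Rightarrow> 'a set" where
  "codifferent K = {\<delta> \<in> K. \<forall>\<alpha>\<in>ring_of_integers K. field_trace K (\<alpha> * \<delta>) \<in> \<int>}"

definition pos_codifferent :: "'a::field_char_0 set \<Rightarrow> 'a set" where
  "pos_codifferent K = {\<delta> \<in> codifferent K. totally_positive K \<delta>}"

end

theory Submission
  imports Defs "HOL-Library.Product_Plus"
begin

text \<open>
  Let \<open>a, b, c\<close> be \<open>2n - 1, 2n + 1, 2n + 3\<close>. The unit \<open>w = (b - \<surd>p - \<surd>q + \<surd>r) / 2\<close> has the same signs as
  \<open>\<surd>r\<close> in all four embeddings, and for totally positive integers \<open>\<alpha>, m\<close> the element
  \<open>\<delta> = w m / (2 \<surd>r)\<close> of the codifferent is totally positive, with \<open>Tr (\<alpha> \<delta>)\<close> equal to the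
  \<open>\<surd>r\<close>-coordinate (the height) of \<open>2 m w \<alpha>\<close>. Up to totally positive units the sail, that is the
  boundary of the convex hull of the totally positive integers, has only two facets, and both lie
  at height 1: one comes from \<open>m = 1\<close>, the other from an element \<open>\<rho>\<close> of norm 4. Descending on the
  height, one replaces \<open>\<beta> = w \<alpha>\<close> by \<open>u \<beta>\<close> for units \<open>u\<close> until \<open>\<beta>\<close>, or \<open>\<rho> \<beta>\<close> for a conjugate of
  \<open>\<rho>\<close>, lies in the cone over one of the facets. The \<open>\<surd>p\<close>-coordinates of the lattice points of
  either facet are \<open>\<plusminus>1 / 2\<close>, so each facet is a Cayley polytope; by the pigeonhole principle an
  integer of height at least 3 in its cone remains in the cone after a suitable lattice point of
  the facet is subtracted, and is therefore decomposable.
\<close>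

section \<open>Rational and integral numbers\<close>

lemma subfield_Rats:
  assumes F: "subfield_of_type (F :: 'a :: field_char_0 set)" shows "\<rat> \<subseteq> F"
proof -
  have nat: "of_nat k \<in> F" for k
    by (induction k) (use F in \<open>auto simp: subfield_of_type_def\<close>)
  have int: "of_int k \<in> F" for k
    by (cases k rule: int_cases2) (use F nat in \<open>auto simp: subfield_of_type_def\<close>)
  show ?thesis
  proof
    fix x :: 'a assume "x \<in> \<rat>"
    then obtain a b where "x = of_int a / of_int b" by (metis Rats_cases')
    then show "x \<in> F" using F int by (auto simp: subfield_of_type_def divide_inverse)
  qed
qed

lemma irrational_lin_indep:
  fixes s :: real
  assumes "s \<notin> \<rat>" "x \<in> \<rat>" "y \<in> \<rat>" "x + y * s = 0"
  shows "x = 0 \<and> y = 0"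
proof -
  have "y = 0"
  proof (rule ccontr)
    assume "y \<noteq> 0"
    then have "s = - x / y" using assms(4) by (simp add: field_simps)
    then show False using assms by simp
  qed
  then show ?thesis using assms by simp
qed

text \<open>A rational root of a monic integer polynomial is an integer, and none lies strictly
  between \<open>k\<close> and \<open>k + 1\<close>.\<close>

lemma irrational_between:
  fixes x :: real and k m :: int
  assumes "x^2 = of_int m" "of_int k < x" "x < of_int k + 1"
  shows "x \<notin> \<rat>"
proof
  assume "x \<in> \<rat>"
  moreover have "algebraic_int x"
    by (rule algebraic_int.intros[of "[:- of_int m, 0, 1:]"])
       (use assms in \<open>auto simp: coeff_pCons power2_eq_square split: nat.splits\<close>)
  ultimately have "x \<in> \<int>" by (rule rational_algebraic_int_is_int[rotated])
  then obtain i where "x = of_int i" by (rule Ints_cases)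
  then show False using assms by simp
qed

lemma embedding_Rats:
  fixes \<sigma> :: "real \<Rightarrow> 'b :: real_field"
  assumes K: "subfield_of_type K" and s: "\<sigma> \<in> field_embeddings K" and x: "x \<in> \<rat>"
  shows "\<sigma> x = of_real x"
proof -
  have Q: "y \<in> K" if "y \<in> \<rat>" for y using subfield_Rats[OF K] that by auto
  have add: "\<sigma> (u + v) = \<sigma> u + \<sigma> v" and mult: "\<sigma> (u * v) = \<sigma> u * \<sigma> v"
    if "u \<in> K" "v \<in> K" for u v
    using s that by (auto simp: field_embeddings_def)
  have one: "\<sigma> 1 = 1" using s by (auto simp: field_embeddings_def)
  have zero: "\<sigma> 0 = 0" using add[of 0 0] Q[of 0] by simp
  have nat: "\<sigma> (of_nat k) = of_nat k" for k
    by (induction k) (simp_all add: zero one add Q)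
  have int: "\<sigma> (of_int k) = of_int k" for k
  proof (cases k rule: int_cases2)
    case (nonneg m) then show ?thesis using nat[of m] by simp
  next
    case (nonpos m)
    have "\<sigma> (of_int k) + \<sigma> (of_nat m) = 0"
      using add[of "of_int k" "of_nat m"] Q[of "of_int k"] Q[of "of_nat m"] nonpos zero by simp
    then show ?thesis using nat[of m] nonpos by (simp add: add_eq_0_iff)
  qed
  obtain a b where ab: "b > 0" "x = of_int a / of_int b" using x by (metis Rats_cases')
  then have "\<sigma> x * of_int b = of_int a" using mult[of x "of_int b"] Q x int by simp
  then have "\<sigma> x = of_int a / of_int b" using ab(1) by (simp add: eq_divide_eq)
  then show ?thesis using ab by simp
qed

text \<open>In lowest terms \<open>y = a / b\<close>, every power of \<open>b\<close> divides
  \<open>d\<close>; but \<open>d < 2 ^ d\<close>, so \<open>b ^ d\<close> is too large unless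
  \<open>b = 1\<close>.\<close>

lemma Ints_if_bounded_denominator:
  fixes y :: real
  assumes y: "y \<in> \<rat>" and d: "d > 0" "\<And>k. of_nat d * y ^ k \<in> \<int>"
  shows "y \<in> \<int>"
proof -
  obtain a b where ab: "b > 0" "y = of_int a / of_int b" "coprime a b" using y by (metis Rats_cases')
  have "b ^ k dvd int d" for k
  proof -
    obtain z where "of_nat d * y ^ k = of_int z" using d(2)[of k] by (rule Ints_cases)
    then have "real_of_int (int d * a ^ k) = of_int (z * b ^ k)" using ab(1,2) by (simp add: field_simps)
    then have "int d * a ^ k = z * b ^ k" by (simp only: of_int_eq_iff)
    then have "b ^ k dvd int d * a ^ k" by simp
    moreover have "coprime (b ^ k) (a ^ k)" using ab(3) by (simp add: coprime_commute)
    ultimately show ?thesis by (simp add: coprime_dvd_mult_left_iff)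
  qed
  then have le: "b ^ d \<le> int d" using d(1) by (intro zdvd_imp_le) auto
  have "b = 1"
  proof (rule ccontr)
    assume "b \<noteq> 1"
    then have "2 ^ d \<le> b ^ d" using ab(1) by (intro power_mono) auto
    moreover have "int d < 2 ^ d" by (metis of_nat_less_two_power)
    ultimately show False using le by linarith
  qed
  then show ?thesis using ab by simp
qed

text \<open>The square of the denominator of \<open>V\<close> in lowest terms divides
  \<open>m\<close>.\<close>

lemma squarefree_Ints:
  fixes V :: real and m :: int
  assumes "squarefree m" "V \<in> \<rat>" "of_int m * V^2 \<in> \<int>"
  shows "V \<in> \<int>"
proof -
  obtain a b where ab: "b > 0" "V = of_int a / of_int b" "coprime a b" using assms(2) by (metis Rats_cases')
  obtain z where "of_int m * V^2 = of_int z" using assms(3) by (rule Ints_cases)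
  then have "real_of_int (m * a^2) = of_int (z * b^2)" using ab(1,2) by (simp add: field_simps)
  then have "m * a^2 = z * b^2" by (simp only: of_int_eq_iff)
  then have "b^2 dvd m * a^2" by simp
  moreover have "coprime (b^2) (a^2)" using ab(3) by (simp add: coprime_commute)
  ultimately have "b^2 dvd m" by (simp add: coprime_dvd_mult_left_iff)
  then have "b dvd 1" using assms(1) by (simp add: squarefree_def)
  then show ?thesis using ab by simp
qed

lemma square_mod_4: "4 dvd (a::int)^2 - (if odd a then 1 else 0)"
proof (cases "odd a")
  case True
  then obtain k where "a = 2 * k + 1" by (rule oddE)
  then have "a^2 - 1 = 4 * (k^2 + k)" by (simp add: power2_eq_square algebra_simps)
  then show ?thesis using True by simp
next
  case False
  then obtain k where "a = 2 * k" by (auto elim: evenE)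
  then show ?thesis by (simp add: power2_eq_square)
qed

lemma sum_squares_4_dvd: "4 dvd (a::int)^2 + b^2 \<Longrightarrow> even a \<and> even b"
  using square_mod_4[of a] square_mod_4[of b] by (cases "odd a"; cases "odd b"; simp; presburger)

lemma diff_squares_4_dvd: "4 dvd (a::int)^2 - b^2 \<Longrightarrow> even a \<longleftrightarrow> even b"
  using square_mod_4[of a] square_mod_4[of b] by (cases "odd a"; cases "odd b"; simp; presburger)

section \<open>Coordinates on the biquadratic field\<close>

type_synonym quad = "real \<times> real \<times> real \<times> real"

text \<open>A pair \<open>(e, f)\<close> of signs names the embedding with \<surd>p \<mapsto> e
  \<surd>p and \<surd>q \<mapsto> f \<surd>q, hence \<surd>r \<mapsto> e f \<surd>r. The signs are
  real so that they multiply coordinates directly.\<close>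

definition signs :: "real set" where "signs = {1, -1}"

locale biquadratic =
  fixes n :: int
  assumes n_pos: "n \<ge> 1"
begin

definition ra :: real where "ra = 2 * of_int n - 1"
definition rb :: real where "rb = 2 * of_int n + 1"
definition rc :: real where "rc = 2 * of_int n + 3"
text \<open>The units and vertices below factor over the roots of the three linear factors, which
  makes their signs visible.\<close>

definition sa :: real where "sa = sqrt ra"
definition sb :: real where "sb = sqrt rb"
definition sc :: real where "sc = sqrt rc"
definition sp :: real where "sp = sa * sb"
definition sq :: real where "sq = sa * sc"
definition sr :: real where "sr = sb * sc"

lemma r_pos: "ra \<ge> 1" "rb > 0" "rc > 0"
  using n_pos by (simp_all add: ra_def rb_def rc_def)

lemma rb_ra: "rb = ra + 2" and rc_ra: "rc = ra + 4"
  by (simp_all add: ra_def rb_def rc_def)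

lemma s_sq: "sa * sa = ra" "sb * sb = rb" "sc * sc = rc"
  using r_pos by (simp_all add: sa_def sb_def sc_def)

lemma s_pos: "0 < sa" "sa < sb" "sb < sc"
  using r_pos by (simp_all add: sa_def sb_def sc_def rb_ra rc_ra)

text \<open>A quadruple \<open>(A, B, C, D)\<close> stands for \<open>(A + B \<surd>p + C \<surd>q + D \<surd>r) / 2\<close>, so that 1 is \<open>(2, 0, 0, 0)\<close>.\<close>

fun emb :: "real \<Rightarrow> real \<Rightarrow> quad \<Rightarrow> real" where
  "emb e f (A, B, C, D) = (A + e * B * sp + f * C * sq + e * f * D * sr) / 2"

text \<open>The field product in doubled coordinates, from \<surd>p \<surd>q = a \<surd>r, \<surd>p
  \<surd>r = b \<surd>q and \<surd>q \<surd>r = c \<surd>p.\<close>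

fun mulq :: "quad \<Rightarrow> quad \<Rightarrow> quad" where
  "mulq (A, B, C, D) (A', B', C', D') =
    ((A * A' + ra * rb * B * B' + ra * rc * C * C' + rb * rc * D * D') / 2,
     (A * B' + B * A' + rc * (C * D' + D * C')) / 2,
     (A * C' + C * A' + rb * (B * D' + D * B')) / 2,
     (A * D' + D * A' + ra * (B * C' + C * B')) / 2)"

fun height :: "quad \<Rightarrow> real" where "height (A, B, C, D) = D"

lemma emb_mulq:
  assumes "e \<in> signs" "f \<in> signs"
  shows "emb e f (mulq x y) = emb e f x * emb e f y"
proof (cases x, cases y)
  fix A B C D A' B' C' D'
  assume "x = (A, B, C, D)" "y = (A', B', C', D')"
  with assms show ?thesis
    by (auto simp: signs_def sp_def sq_def sr_def s_sq[symmetric] field_simps)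
qed

lemma emb_add: "emb e f (x + y) = emb e f x + emb e f y"
  by (cases x; cases y) (simp add: field_simps)

lemma emb_diff: "emb e f (x - y) = emb e f x - emb e f y"
  by (cases x; cases y) (simp add: field_simps)

lemma mulq_assoc: "mulq (mulq x y) z = mulq x (mulq y z)"
  by (cases x; cases y; cases z) (simp add: field_simps)

lemma mulq_comm: "mulq x y = mulq y x"
  by (cases x; cases y) (simp add: field_simps)

lemma mulq_add: "mulq x (y + z) = mulq x y + mulq x z"
  by (cases x; cases y; cases z) (simp add: field_simps)

lemma mulq_diff: "mulq x (y - z) = mulq x y - mulq x z"
  by (cases x; cases y; cases z) (simp add: field_simps)

lemma mulq_one: "mulq (2, 0, 0, 0) x = x"
  by (cases x) simp

text \<open>These parities describe the ring of integers, because p and r are 3 and q is 1 modulo 4;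
  the proof is in \<open>algebraic_int_intq\<close> and \<open>intq_algebraic_int\<close>.\<close>

definition intq :: "quad \<Rightarrow> bool" where
  "intq x \<longleftrightarrow> (\<exists>A B C D :: int. x = (of_int A, of_int B, of_int C, of_int D) \<and> even (A - C) \<and> even (B - D))"

lemma intqI: "even (A - C) \<Longrightarrow> even (B - D) \<Longrightarrow> intq (real_of_int A, real_of_int B, real_of_int C, real_of_int D)"
  by (auto simp: intq_def)

lemma intq_diff: "intq x \<Longrightarrow> intq y \<Longrightarrow> intq (x - y)"
  unfolding intq_def
  by (elim exE conjE, simp only: diff_Pair of_int_diff[symmetric] prod.inject of_int_eq_iff)
     (intro exI conjI, rule refl, rule refl, rule refl, rule refl, auto)

lemma intq_mulq:
  assumes "intq x" "intq y"
  shows "intq (mulq x y)"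
proof -
  obtain A B C D where x: "x = (real_of_int A, real_of_int B, real_of_int C, real_of_int D)"
    and e: "even (A - C)" "even (B - D)" using assms(1) by (auto simp: intq_def)
  obtain A' B' C' D' where y: "y = (real_of_int A', real_of_int B', real_of_int C', real_of_int D')"
    and e': "even (A' - C')" "even (B' - D')" using assms(2) by (auto simp: intq_def)
  obtain k where k: "A = C + 2 * k" using e(1) by (metis dvd_def add.commute diff_add_cancel)
  obtain l where l: "B = D + 2 * l" using e(2) by (metis dvd_def add.commute diff_add_cancel)
  obtain k' where k': "A' = C' + 2 * k'" using e'(1) by (metis dvd_def add.commute diff_add_cancel)
  obtain l' where l': "B' = D' + 2 * l'" using e'(2) by (metis dvd_def add.commute diff_add_cancel)
  \<comment> \<open>With \<open>A = C + 2 * k\<close>, \<open>B = D + 2 * l\<close> and likewise for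
    \<open>y\<close>, the halves in \<open>mulq\<close> cancel; these are the resulting integer
    coordinates.\<close>
  define P where "P = (2*n*n + 2*n - 1) * C * C' + C * k' + C' * k + 2 * k * k'
     + (4*n*n+4*n+1) * D * D' + (4*n*n-1) * (D * l' + D' * l + 2 * l * l')"
  define Q where "Q = (n + 2) * (C * D' + D * C') + C * l' + k * D' + 2 * k * l' + l * C' + D * k' + 2 * l * k'"
  define R where "R = C * C' + C * k' + C' * k + (2*n+1) * (D * D' + l * D' + D * l')"
  define S where "S = n * (C * D' + C' * D) + k * D' + k' * D + (2*n-1) * (l * C' + C * l')"
  have 1: "mulq x y = (of_int P, of_int Q, of_int R, of_int S)"
    unfolding x y k l k' l' P_def Q_def R_def S_def by (simp add: ra_def rb_def rc_def field_simps)
  have 2: "P - R = 2 * ((n*n + n - 1) * C * C' + k * k' + (2*n*n+n) * D * D'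
      + (2*n*n - n - 1) * (D * l' + D' * l) + (4*n*n-1) * l * l')"
    unfolding P_def R_def by (simp add: algebra_simps)
  have 3: "Q - S = 2 * (C * D' + D * C' + k * l' + l * k' + (1 - n) * (l * C' + C * l'))"
    unfolding Q_def S_def by (simp add: algebra_simps)
  have "even (P - R)" "even (Q - S)" unfolding 2 3 by simp_all
  then show ?thesis unfolding 1 by (rule intqI)
qed

section \<open>Sign conditions in the four embeddings\<close>

definition posq :: "quad \<Rightarrow> bool" where
  "posq x \<longleftrightarrow> (\<forall>e\<in>signs. \<forall>f\<in>signs. 0 < emb e f x)"

text \<open>The signs of \<surd>r in all embeddings. Multiplication by the unit w carries totally
  positive integers to integers of this kind, for which the height is positive.\<close>

definition twisted_pos :: "quad \<Rightarrow> bool" where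
  "twisted_pos x \<longleftrightarrow> (\<forall>e\<in>signs. \<forall>f\<in>signs. 0 < e * f * emb e f x)"

lemma posq_mulq: "posq x \<Longrightarrow> posq y \<Longrightarrow> posq (mulq x y)"
  by (auto simp: posq_def emb_mulq)

lemma twisted_pos_mulq: "posq x \<Longrightarrow> twisted_pos y \<Longrightarrow> twisted_pos (mulq x y)"
  unfolding twisted_pos_def posq_def by (simp add: emb_mulq mult.left_commute[of _ "emb _ _ x"])

lemma twisted_pos_mulq_cancel:
  assumes "posq x" "twisted_pos (mulq x y)" shows "twisted_pos y"
  unfolding twisted_pos_def
proof (intro ballI)
  fix e f assume ef: "e \<in> signs" "f \<in> signs"
  then have "0 < emb e f x" "0 < emb e f x * (e * f * emb e f y)"
    using assms by (auto simp: twisted_pos_def posq_def emb_mulq mult_ac)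
  then show "0 < e * f * emb e f y" by (simp add: zero_less_mult_iff)
qed

lemma twisted_pos_iff:
  "twisted_pos (A, B, C, D) \<longleftrightarrow>
    0 < A + B * sp + C * sq + D * sr \<and> 0 < A - B * sp - C * sq + D * sr \<and>
    0 < - A + B * sp - C * sq + D * sr \<and> 0 < - A - B * sp + C * sq + D * sr"
  by (auto simp: twisted_pos_def signs_def)

text \<open>The four inequalities add up to \<open>4 * D * sr > 0\<close>.\<close>

lemma twisted_pos_height_pos: "twisted_pos x \<Longrightarrow> height x > 0"
proof (cases x)
  fix A B C D assume "twisted_pos x" and x: "x = (A, B, C, D)"
  then have "D * sr > 0" unfolding x twisted_pos_iff by linarith
  moreover have "sr > 0" using s_pos by (simp add: sr_def)
  ultimately show ?thesis using x by (simp add: zero_less_mult_iff)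
qed

definition splits :: "quad \<Rightarrow> bool" where
  "splits x \<longleftrightarrow> (\<exists>y z. intq y \<and> intq z \<and> twisted_pos y \<and> twisted_pos z \<and> x = y + z)"

section \<open>The cones over the two facets\<close>

text \<open>With \<open>B = i - j\<close> and \<open>D = i + j\<close>: the fibre of the cone over the first facet is the Minkowski sum
  \<open>i P + j P'\<close> of two centrally symmetric hexagons, and \<open>C + Z\<close> and \<open>- Z\<close> are the \<open>C\<close>-coordinates
  of the two summands.\<close>

definition in_facet_cone :: "real \<Rightarrow> real \<Rightarrow> real \<Rightarrow> real \<Rightarrow> real \<Rightarrow> bool" where
  "in_facet_cone A C i j Z \<longleftrightarrow> \<bar>Z\<bar> \<le> j \<and> \<bar>C + Z\<bar> \<le> i \<and>
     \<bar>A - 2 * of_int n * (C + 2 * Z)\<bar> + \<bar>C + Z\<bar> + \<bar>Z\<bar> \<le> 2 * (i + j)"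

text \<open>The conjugation fixing \<surd>r negates \<open>B\<close> and \<open>C\<close>, so the
  two hexagons trade places.\<close>

lemma facet_cone_swap: "in_facet_cone A C i j Z \<Longrightarrow> in_facet_cone A (- C) j i (C + Z)"
  by (auto simp: in_facet_cone_def algebra_simps)

text \<open>Minus the conjugation fixing \<surd>q, an operation that preserves
  \<open>twisted_pos\<close>.\<close>

lemma facet_cone_neg: "in_facet_cone A C i j Z \<Longrightarrow> in_facet_cone (- A) (- C) i j (- Z)"
  unfolding in_facet_cone_def by (auto simp: algebra_simps abs_if split: if_splits)

lemma sp_sq_sr_bounds:
  "\<bar>sq - 2 * of_int n\<bar> \<le> 1" "sr - sp > 2" "sr + sp > sq + 2 * of_int n + 1"
proof -
  define N :: real where "N = of_int n"
  have N: "N \<ge> 1" using n_pos by (simp add: N_def)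
  have p0: "sp > 0" "sq > 0" "sr > 0" using s_pos by (simp_all add: sp_def sq_def sr_def)
  have p2: "sp^2 = 4 * N^2 - 1" "sq^2 = 4 * N^2 + 4 * N - 3" "sr^2 = 4 * N^2 + 8 * N + 3"
    "sr * sp = (2 * N + 1) * sq"
  proof -
    have "sp^2 = (sa * sa) * (sb * sb)" "sq^2 = (sa * sa) * (sc * sc)" "sr^2 = (sb * sb) * (sc * sc)"
      "sr * sp = (sb * sb) * sq"
      by (simp_all add: sp_def sq_def sr_def power2_eq_square mult_ac)
    then show "sp^2 = 4 * N^2 - 1" "sq^2 = 4 * N^2 + 4 * N - 3" "sr^2 = 4 * N^2 + 8 * N + 3"
      "sr * sp = (2 * N + 1) * sq"
      by (simp_all add: s_sq ra_def rb_def rc_def N_def power2_eq_square algebra_simps)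
  qed
  have "2 * N \<le> sq" by (rule power2_le_imp_le) (use N p0 p2 in \<open>auto simp: power_mult_distrib\<close>)
  moreover have "sq \<le> 2 * N + 1"
    by (rule power2_le_imp_le) (use N p0 p2 in \<open>auto simp: power2_eq_square algebra_simps\<close>)
  ultimately show "\<bar>sq - 2 * of_int n\<bar> \<le> 1" by (simp add: N_def)
  have "sp < 2 * N" by (rule power2_less_imp_less) (use N p0 p2 in \<open>auto simp: power_mult_distrib\<close>)
  then have "(sp + 2)^2 < sr^2" unfolding p2 power2_sum by (simp add: p2)
  then have "sp + 2 < sr" by (rule power2_less_imp_less) (use p0 in simp)
  then show "sr - sp > 2" by simp
  \<comment> \<open>The cross terms agree by \<open>sr * sp = (2 * N + 1) * sq\<close>; the rest of
    the two squares differs by 4.\<close>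
  have "(sq + (2 * N + 1))^2 < (sr + sp)^2"
    unfolding power2_sum p2 using p2(4) by (simp add: power2_eq_square algebra_simps)
  then have "sq + (2 * N + 1) < sr + sp" by (rule power2_less_imp_less) (use p0 in simp)
  then show "sr + sp > sq + 2 * of_int n + 1" by (simp add: N_def)
qed

text \<open>With \<open>A\<close> replaced by its lower bound, the expression splits into a part in
  \<open>X = C + Z\<close>, a part in \<open>Z\<close> and a part in \<open>i, j\<close>. The first
  two are bounded below by 1 and 2, and what remains is the positive quantity in 3.\<close>

lemma facet_cone_pos:
  assumes g: "in_facet_cone A C i j Z" and ij: "i + j > 0"
  shows "0 < A - (i - j) * sp - C * sq + (i + j) * sr"
proof -
  define N :: real where "N = of_int n"
  have N: "N \<ge> 1" using n_pos by (simp add: N_def)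
  define X where "X = C + Z"
  have b: "\<bar>Z\<bar> \<le> j" "\<bar>X\<bar> \<le> i" "\<bar>A - 2 * N * (X + Z)\<bar> + \<bar>X\<bar> + \<bar>Z\<bar> \<le> 2 * (i + j)"
    using g by (simp_all add: in_facet_cone_def X_def N_def algebra_simps)
  note k = sp_sq_sr_bounds[folded N_def]
  have "\<bar>X * (sq - 2 * N)\<bar> \<le> \<bar>X\<bar>"
    unfolding abs_mult using k(1) mult_left_mono[of "\<bar>sq - 2 * N\<bar>" 1 "\<bar>X\<bar>"] by simp
  then have 1: "0 \<le> X * (2 * N - sq) + \<bar>X\<bar>" by (simp add: algebra_simps)
  have s: "2 * N + sq - 1 \<ge> 0" using N k(1) by linarith
  have "- (j * (2 * N + sq - 1)) \<le> - (\<bar>Z\<bar> * (2 * N + sq - 1))"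
    using mult_right_mono[OF b(1) s] by simp
  also have "\<dots> = - (\<bar>Z\<bar> * (2 * N + sq)) + \<bar>Z\<bar>" by (simp add: algebra_simps)
  also have "\<dots> \<le> Z * (2 * N + sq) + \<bar>Z\<bar>"
    using mult_right_mono[of "- \<bar>Z\<bar>" Z "2 * N + sq"] s by simp
  finally have 2: "0 \<le> Z * (2 * N + sq) + \<bar>Z\<bar> + j * (2 * N + sq - 1)" by simp
  have ij0: "i \<ge> 0" "j \<ge> 0" using b by linarith+
  have 3: "0 < i * (sr - sp - 2) + j * (sr + sp - sq - 2 * N - 1)"
  proof (cases "i > 0")
    case True then show ?thesis using k ij0 by (intro add_pos_nonneg mult_pos_pos mult_nonneg_nonneg) auto
  next
    case False then have "i = 0" "j > 0" using ij ij0 by auto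
    then show ?thesis using k by simp
  qed
  have "A \<ge> 2 * N * (X + Z) - 2 * (i + j) + \<bar>X\<bar> + \<bar>Z\<bar>" using b(3) by linarith
  moreover have C: "C = X - Z" by (simp add: X_def)
  ultimately show ?thesis using 1 2 3 unfolding C by (simp add: algebra_simps)
qed

text \<open>The symmetries of the cone permute the four sign conditions, so
  \<open>facet_cone_pos\<close> covers all of them.\<close>

lemma facet_cone_twisted_pos:
  assumes g: "in_facet_cone A C i j Z" and ij: "i + j > 0"
  shows "twisted_pos (A, i - j, C, i + j)"
  using facet_cone_pos[OF g ij] facet_cone_pos[OF facet_cone_swap[OF g]] facet_cone_pos[OF facet_cone_neg[OF g] ij]
    facet_cone_pos[OF facet_cone_neg[OF facet_cone_swap[OF g]]] ij
  unfolding twisted_pos_iff by (simp add: algebra_simps)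

text \<open>Elimination of \<open>Z\<close>: the first two conditions on \<open>Z\<close> define an
  interval, nonempty by the bound on \<open>C\<close>, and at its endpoints the walls
  \<open>f1\<close> to \<open>f4\<close> supply the third condition.\<close>

lemma walls_facet_cone:
  assumes "i \<ge> 0" "j \<ge> 0" "\<bar>C\<bar> \<le> i + j"
    and f1: "\<bar>A - (2 * of_int n - 1) * C\<bar> \<le> 2 * i + 4 * of_int n * j"
    and f2: "\<bar>A - (2 * of_int n + 1) * C\<bar> \<le> 2 * i + (4 * of_int n + 2) * j"
    and f3: "\<bar>A + (2 * of_int n - 1) * C\<bar> \<le> 2 * j + 4 * of_int n * i"
    and f4: "\<bar>A + (2 * of_int n + 1) * C\<bar> \<le> 2 * j + (4 * of_int n + 2) * i"
  shows "\<exists>Z. in_facet_cone A C i j Z"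
proof -
  define N :: real where "N = of_int n"
  have N: "N \<ge> 1" using n_pos by (simp add: N_def)
  note f = f1[folded N_def] f2[folded N_def] f3[folded N_def] f4[folded N_def]
  \<comment> \<open>The value of \<open>Z\<close> at which \<open>A - 2 * n * (C + 2 * Z)\<close>
    vanishes.\<close>
  define Y where "Y = (A / (2 * N) - C) / 2"
  have A: "A = 2 * N * (C + 2 * Y)" using N by (simp add: Y_def field_simps)
  have AZ: "A - 2 * N * (C + 2 * Z) = 4 * (N * (Y - Z))" for Z by (simp add: A algebra_simps)
  have sgn: "0 \<le> A - 2 * N * (C + 2 * Z)" if "Z \<le> Y" for Z
    unfolding AZ using that N by simp
  have sgn': "A - 2 * N * (C + 2 * Z) \<le> 0" if "Y \<le> Z" for Z
    unfolding AZ using that N by (simp add: mult_nonneg_nonpos)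
  \<comment> \<open>\<open>Y\<close> is clipped to the interval from max (-j) (-i - C) to min j (i -
    C): four endpoint cases and the interior.\<close>
  consider "j \<le> Y" "j \<le> i - C" | "i - C \<le> Y" "i - C \<le> j" | "Y \<le> -j" "- i - C \<le> - j"
    | "Y \<le> - i - C" "- j \<le> - i - C" | "-j \<le> Y" "Y \<le> j" "- i - C \<le> Y" "Y \<le> i - C"
    by linarith
  then show ?thesis
  proof cases
    case 1
    have "in_facet_cone A C i j j"
      unfolding in_facet_cone_def N_def[symmetric] abs_of_nonneg[OF sgn[OF 1(1)]]
      using 1 assms(1-3) f by (auto simp: abs_if algebra_simps split: if_splits)
    then show ?thesis ..
  next
    case 2
    have "in_facet_cone A C i j (i - C)"
      unfolding in_facet_cone_def N_def[symmetric] abs_of_nonneg[OF sgn[OF 2(1)]]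
      using 2 assms(1-3) f by (auto simp: abs_if algebra_simps split: if_splits)
    then show ?thesis ..
  next
    case 3
    have "in_facet_cone A C i j (- j)"
      unfolding in_facet_cone_def N_def[symmetric] abs_of_nonpos[OF sgn'[OF 3(1)]]
      using 3 assms(1-3) f by (auto simp: abs_if algebra_simps split: if_splits)
    then show ?thesis ..
  next
    case 4
    have "in_facet_cone A C i j (- i - C)"
      unfolding in_facet_cone_def N_def[symmetric] abs_of_nonpos[OF sgn'[OF 4(1)]]
      using 4 assms(1-3) f by (auto simp: abs_if algebra_simps split: if_splits)
    then show ?thesis ..
  next
    case 5
    have "in_facet_cone A C i j Y"
      unfolding in_facet_cone_def N_def[symmetric] AZ using 5 assms(1,2) by (auto simp: abs_if)
    then show ?thesis ..
  qed
qed

text \<open>The point \<open>(k + 2 * n * m, m)\<close> is a lattice point of the first hexagon,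
  chosen by the signs and sizes of \<open>s\<close> and \<open>X\<close>, while \<open>Z\<close>
  stays fixed. Either the sum of absolute values drops by 2, or it is small enough afterwards
  because \<open>i + j \<ge> 3\<close>.\<close>

lemma facet_cone_step:
  fixes i j :: int
  assumes g: "in_facet_cone A C i j Z" and ij: "i \<ge> 2" "j \<ge> 0" "i + j \<ge> 3"
  shows "\<exists>k m :: int. even (k - m) \<and> \<bar>k\<bar> + \<bar>m\<bar> \<le> 2 \<and> \<bar>m\<bar> \<le> 1 \<and>
    in_facet_cone (A - (k + 2 * n * m)) (C - m) (i - 1) j Z"
proof -
  define X where "X = C + Z"
  define s where "s = A - 2 * of_int n * (C + 2 * Z)"
  have b: "\<bar>Z\<bar> \<le> j" "\<bar>X\<bar> \<le> i" "\<bar>s\<bar> + \<bar>X\<bar> + \<bar>Z\<bar> \<le> 2 * (i + j)"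
    using g by (simp_all add: in_facet_cone_def X_def s_def)
  have step: ?thesis if "even (k - m)" "\<bar>k\<bar> + \<bar>m\<bar> \<le> 2" "\<bar>m\<bar> \<le> 1" "\<bar>X - m\<bar> \<le> i - 1"
      "\<bar>s - k\<bar> + \<bar>X - m\<bar> + \<bar>Z\<bar> \<le> 2 * (i + j) - 2" for k m :: int
  proof (intro exI conjI)
    show "in_facet_cone (A - (k + 2 * n * m)) (C - m) (i - 1) j Z"
      using that b unfolding in_facet_cone_def s_def X_def by (simp add: algebra_simps)
  qed (use that in auto)
  have ij': "real_of_int i \<ge> 2" "real_of_int j \<ge> 0" "real_of_int i + real_of_int j \<ge> 3" using ij by linarith+
  consider "X \<ge> 1" "s \<ge> 0" | "X \<ge> 1" "s \<le> 0" | "X \<le> -1" "s \<ge> 0" | "X \<le> -1" "s \<le> 0" |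
    "\<bar>X\<bar> < 1" "s \<ge> 2" | "\<bar>X\<bar> < 1" "s \<le> -2" | "\<bar>X\<bar> < 1" "\<bar>s\<bar> < 2" by linarith
  then show ?thesis
  proof cases
    case 1 show ?thesis by (rule step[of 1 1]) (use 1 b ij' in auto)
  next
    case 2 show ?thesis by (rule step[of "-1" 1]) (use 2 b ij' in auto)
  next
    case 3 show ?thesis by (rule step[of 1 "-1"]) (use 3 b ij' in auto)
  next
    case 4 show ?thesis by (rule step[of "-1" "-1"]) (use 4 b ij' in auto)
  next
    case 5 show ?thesis by (rule step[of 2 0]) (use 5 b ij' in auto)
  next
    case 6 show ?thesis by (rule step[of "-2" 0]) (use 6 b ij' in auto)
  next
    case 7
    \<comment> \<open>Here the centre of the hexagon is subtracted; the sum need not drop, since it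
      is at most \<open>3 + j\<close>.\<close>
    have "\<bar>s\<bar> + \<bar>X\<bar> + \<bar>Z\<bar> \<le> 2 + 1 + real_of_int j" using 7 b(1) by (intro add_mono) auto
    also have "2 + 1 + real_of_int j \<le> 2 * (real_of_int i + real_of_int j) - 2"
      unfolding distrib_left using ij'(1,3) by linarith
    finally have "\<bar>s\<bar> + \<bar>X\<bar> + \<bar>Z\<bar> \<le> 2 * (real_of_int i + real_of_int j) - 2" .
    then show ?thesis by (intro step[of 0 0]) (use 7 b ij' in auto)
  qed
qed

lemma vertex_facet_cone: "\<bar>k\<bar> + \<bar>m\<bar> \<le> (2::int) \<Longrightarrow> \<bar>m\<bar> \<le> 1 \<Longrightarrow> in_facet_cone (k + 2 * n * m) m 1 0 0"
  by (simp add: in_facet_cone_def) linarith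


lemma splitsI:
  assumes "intq x" "intq v" "twisted_pos v" "twisted_pos (x - v)" shows "splits x"
  unfolding splits_def using assms intq_diff[OF assms(1,2)] by (intro exI[of _ v] exI[of _ "x - v"]) auto

text \<open>Pigeonhole: \<open>i \<ge> 2\<close> or \<open>j \<ge> 2\<close>, so a lattice point
  with \<open>B = 1\<close> or \<open>B = -1\<close> can be removed; the second case is the first
  one after \<open>facet_cone_swap\<close>.\<close>

lemma facet_cone_splits:
  fixes A C i j :: int
  assumes g: "in_facet_cone A C i j Z" and ij: "i \<ge> 0" "j \<ge> 0" "i + j \<ge> 3"
    and i: "intq (real_of_int A, real_of_int i - real_of_int j, real_of_int C, real_of_int i + real_of_int j)"
  shows "splits (real_of_int A, real_of_int i - real_of_int j, real_of_int C, real_of_int i + real_of_int j)"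
proof (cases "i \<ge> 2")
  case True
  then obtain k m :: int where km: "even (k - m)" "\<bar>k\<bar> + \<bar>m\<bar> \<le> 2" and m1: "\<bar>m\<bar> \<le> 1"
    and g': "in_facet_cone (real_of_int A - (k + 2 * n * m)) (real_of_int C - m) (i - 1) j Z"
    using facet_cone_step[OF g] ij by blast
  show ?thesis
  proof (rule splitsI[OF i])
    show "intq (real_of_int (k + 2 * n * m), 1, real_of_int m, 1)"
      using intqI[of "k + 2 * n * m" m 1 1] km by simp
    show "twisted_pos (real_of_int (k + 2 * n * m), 1, real_of_int m, 1)"
      using facet_cone_twisted_pos[OF vertex_facet_cone[OF km(2) m1]] by simp
    show "twisted_pos ((real_of_int A, real_of_int i - real_of_int j, real_of_int C, real_of_int i + real_of_int j) - (real_of_int (k + 2 * n * m), 1, real_of_int m, 1))"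
      using facet_cone_twisted_pos[OF g'] ij by (simp add: algebra_simps)
  qed
next
  case False
  then have "j \<ge> 2" using ij by simp
  moreover have "in_facet_cone A (real_of_int (- C)) j i (C + Z)" using facet_cone_swap[OF g] by simp
  ultimately obtain k m :: int where km: "even (k - m)" "\<bar>k\<bar> + \<bar>m\<bar> \<le> 2" and m1: "\<bar>m\<bar> \<le> 1"
    and g': "in_facet_cone (real_of_int A - (k + 2 * n * m)) (real_of_int (- C) - m) (j - 1) i (C + Z)"
    using facet_cone_step[of A "real_of_int (- C)" j i "C + Z"] ij by auto
  show ?thesis
  proof (rule splitsI[OF i])
    show "intq (real_of_int (k + 2 * n * m), -1, - real_of_int m, 1)"
      using intqI[of "k + 2 * n * m" "- m" "-1" 1] km by simp
    show "twisted_pos (real_of_int (k + 2 * n * m), -1, - real_of_int m, 1)"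
      using facet_cone_twisted_pos[OF facet_cone_swap[OF vertex_facet_cone[OF km(2) m1]]] by simp
    show "twisted_pos ((real_of_int A, real_of_int i - real_of_int j, real_of_int C, real_of_int i + real_of_int j) - (real_of_int (k + 2 * n * m), -1, - real_of_int m, 1))"
      using facet_cone_twisted_pos[OF facet_cone_swap[OF g']] ij by (simp add: algebra_simps)
  qed
qed

text \<open>The second facet is a simplex with vertices \<open>vert f g\<close>; \<open>vert_coef f g x\<close> is \<open>4 a\<close> times the
  coefficient of \<open>x\<close> at that vertex.\<close>

definition vert_coef :: "real \<Rightarrow> real \<Rightarrow> quad \<Rightarrow> real" where
  "vert_coef f g = (\<lambda>(A, B, C, D). ra * D + f * g * A + f * ra * B + g * ra * C)"

definition vert :: "real \<Rightarrow> real \<Rightarrow> quad" where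
  "vert f g = (f * g * ra, f, g, 1)"

text \<open>Twice the value of \<open>vert f g\<close> under the identity embedding is
  \<open>(sb + g * sa) * (sc + f * sa)\<close>. The smallest of these four weights is
  \<open>v > 0\<close>, and the four coefficients add up to \<open>4 * ra * D\<close>.\<close>

lemma vert_coef_pos:
  assumes "0 \<le> ra * D + A + ra * B + ra * C" "0 \<le> ra * D - A + ra * B - ra * C"
    "0 \<le> ra * D - A - ra * B + ra * C" "0 \<le> ra * D + A - ra * B - ra * C" "D > 0"
  shows "0 < A + B * sp + C * sq + D * sr"
proof -
  define v where "v = (sb - sa) * (sc - sa)"
  have s: "0 < sa" "sa < sb" "sb < sc" by (rule s_pos)+
  have v: "0 < v" "v \<le> (sb + sa) * (sc + sa)" "v \<le> (sb - sa) * (sc + sa)" "v \<le> (sb + sa) * (sc - sa)"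
    unfolding v_def using s by (auto intro!: mult_mono mult_pos_pos)
  have "4 * ra * (A + B * sp + C * sq + D * sr) =
    (ra * D + A + ra * B + ra * C) * ((sb + sa) * (sc + sa)) + (ra * D - A + ra * B - ra * C) * ((sb - sa) * (sc + sa))
    + (ra * D - A - ra * B + ra * C) * ((sb + sa) * (sc - sa)) + (ra * D + A - ra * B - ra * C) * v"
    by (simp add: v_def sp_def sq_def sr_def s_sq[symmetric] algebra_simps)
  also have "\<dots> \<ge> (ra * D + A + ra * B + ra * C) * v + (ra * D - A + ra * B - ra * C) * v
    + (ra * D - A - ra * B + ra * C) * v + (ra * D + A - ra * B - ra * C) * v"
    using assms v by (intro add_mono mult_left_mono) auto
  also have "(ra * D + A + ra * B + ra * C) * v + (ra * D - A + ra * B - ra * C) * v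
    + (ra * D - A - ra * B + ra * C) * v + (ra * D + A - ra * B - ra * C) * v = 4 * ra * (D * v)"
    by (simp add: algebra_simps)
  finally have "4 * ra * (D * v) \<le> 4 * ra * (A + B * sp + C * sq + D * sr)" .
  then have "D * v \<le> A + B * sp + C * sq + D * sr" using r_pos by simp
  moreover have "D * v > 0" using v assms by simp
  ultimately show ?thesis by simp
qed

lemma vert_coef_twisted_pos:
  assumes "\<And>f g. f \<in> signs \<Longrightarrow> g \<in> signs \<Longrightarrow> 0 \<le> vert_coef f g x" "height x > 0"
  shows "twisted_pos x"
proof (cases x)
  case (fields A B C D)
  have c: "0 \<le> ra * D + A + ra * B + ra * C" "0 \<le> ra * D - A + ra * B - ra * C"
    "0 \<le> ra * D - A - ra * B + ra * C" "0 \<le> ra * D + A - ra * B - ra * C" "D > 0"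
    using assms(1)[of 1 1] assms(1)[of 1 "-1"] assms(1)[of "-1" 1] assms(1)[of "-1" "-1"] assms(2)
    by (simp_all add: vert_coef_def signs_def fields)
  show ?thesis
    unfolding fields twisted_pos_iff
    using vert_coef_pos[of D A B C] vert_coef_pos[of D A "-B" "-C"] vert_coef_pos[of D "-A" B "-C"] vert_coef_pos[of D "-A" "-B" C] c
    by simp
qed

text \<open>The coefficients at \<open>vert f 1\<close> and \<open>vert f (-1)\<close> add up to \<open>(D + f B) / 2\<close>, which is an integer
  because \<open>B\<close> and \<open>D\<close> have the same parity.\<close>

lemma vert_coef_step:
  assumes c: "\<And>f g. f \<in> signs \<Longrightarrow> g \<in> signs \<Longrightarrow> 0 \<le> vert_coef f g x" and i: "intq x" and d: "height x \<ge> 3"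
  shows "\<exists>f\<in>signs. \<exists>g\<in>signs. twisted_pos (x - vert f g)"
proof -
  obtain A B C D :: int where x: "x = (of_int A, of_int B, of_int C, of_int D)" and e: "even (B - D)"
    using i by (auto simp: intq_def)
  have D: "D \<ge> 3" using d x by simp
  have "\<exists>f\<in>signs. \<exists>g\<in>signs. vert_coef f g x \<ge> 4 * ra"
  proof -
    \<comment> \<open>Both numbers are even and their sum \<open>2 * D\<close> is at least
      6.\<close>
    have "D + B \<ge> 4 \<or> D - B \<ge> 4" using e D by presburger
    then have "\<exists>f\<in>signs. real_of_int D + f * B \<ge> 4" by (auto simp: signs_def)
    then obtain f where f: "f \<in> signs" "real_of_int D + f * B \<ge> 4" by auto
    have "vert_coef f 1 x + vert_coef f (-1) x = 2 * ra * (real_of_int D + f * B)"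
      by (simp add: vert_coef_def x algebra_simps)
    also have "\<dots> \<ge> 2 * ra * 4" using f r_pos by (intro mult_left_mono) auto
    finally have "vert_coef f 1 x \<ge> 4 * ra \<or> vert_coef f (-1) x \<ge> 4 * ra" by linarith
    then show ?thesis using f by (auto simp: signs_def)
  qed
  then obtain f g where fg: "f \<in> signs" "g \<in> signs" "vert_coef f g x \<ge> 4 * ra" by auto
  \<comment> \<open>The functionals \<open>vert_coef\<close> are dual to the vertices up to the
    factor \<open>4 * ra\<close>, so only one coefficient changes.\<close>
  have "vert_coef f' g' (x - vert f g) = vert_coef f' g' x - (if f' = f \<and> g' = g then 4 * ra else 0)"
    if "f' \<in> signs" "g' \<in> signs" for f' g'
    using that fg(1,2) by (auto simp: vert_coef_def vert_def x signs_def algebra_simps)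
  moreover have "height (x - vert f g) > 0" using D by (simp add: x vert_def)
  ultimately have "twisted_pos (x - vert f g)" using c fg by (intro vert_coef_twisted_pos) auto
  then show ?thesis using fg by auto
qed

section \<open>Units and descent on the height\<close>

text \<open>The four conjugates of \<rho>, an element of norm 4: under the identity embedding,
  \<open>rho e f\<close> is \<open>(sc + f * sa) * (sc - e * f * sb) / 2\<close>.\<close>

definition rho :: "real \<Rightarrow> real \<Rightarrow> quad" where
  "rho e f = (rc, - e, f, - (e * f))"

text \<open>Totally positive units of norm 1 in the three quadratic subfields: (b + e \<surd>q) / 2,
  2n + e \<surd>p and 2n + 2 + e \<surd>r.\<close>

definition epsq :: "real \<Rightarrow> quad" where "epsq e = (rb, 0, e, 0)"
definition epsp :: "real \<Rightarrow> quad" where "epsp e = (4 * of_int n, 2 * e, 0, 0)"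
definition epsr :: "real \<Rightarrow> quad" where "epsr e = (4 * of_int n + 4, 0, 0, 2 * e)"

definition unitq :: "quad \<Rightarrow> bool" where
  "unitq u \<longleftrightarrow> intq u \<and> posq u \<and> (\<exists>v. intq v \<and> posq v \<and> mulq u v = (2, 0, 0, 0))"

lemma signs_int: "e \<in> signs \<Longrightarrow> \<exists>k::int. e = of_int k \<and> odd k"
  unfolding signs_def by (auto intro: exI[of _ 1] exI[of _ "-1"])

lemma signs_neg: "e \<in> signs \<Longrightarrow> - e \<in> signs" and signs_mult: "e \<in> signs \<Longrightarrow> f \<in> signs \<Longrightarrow> e * f \<in> signs"
  by (auto simp: signs_def)

lemma intq_rho: assumes "e \<in> signs" "f \<in> signs" shows "intq (rho e f)"
proof -
  obtain k l where "e = of_int k" "odd k" "f = of_int l" "odd l" using assms signs_int by meson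
  then show ?thesis using intqI[of "2*n+3" l "-k" "-(k*l)"] by (simp add: rho_def rc_def)
qed

lemma posq_rho: assumes "e \<in> signs" "f \<in> signs" shows "posq (rho e f)"
proof -
  have "0 < emb e' f' (rho e f)" if "e' \<in> signs" "f' \<in> signs" for e' f'
  proof -
    have s: "0 < sa" "sa < sb" "sb < sc" by (rule s_pos)+
    have "emb e' f' (rho e f) = (sc + f * f' * sa) * (sc - e * f * (e' * f') * sb) / 2"
      using assms that by (auto simp: signs_def rho_def sp_def sq_def sr_def s_sq[symmetric] field_simps)
    moreover have "0 < (sc + f * f' * sa) * (sc - e * f * (e' * f') * sb)"
      using assms that s by (intro mult_pos_pos) (auto simp: signs_def)
    ultimately show ?thesis by linarith
  qed
  then show ?thesis by (simp add: posq_def)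
qed

lemma unit_eps:
  assumes "e \<in> signs"
  shows "unitq (epsp e)" "unitq (epsq e)" "unitq (epsr e)"
proof -
  have s: "0 < sa" "sa < sb" "sb < sc" by (rule s_pos)+
  have i: "intq (epsp e)" "intq (epsq e)" "intq (epsr e)" if es: "e \<in> signs" for e
  proof -
    obtain k where "e = of_int k" "odd k" using signs_int[OF es] by auto
    then show "intq (epsp e)" "intq (epsq e)" "intq (epsr e)"
      using intqI[of "4*n" 0 "2*k" 0] intqI[of "2*n+1" k 0 0] intqI[of "4*n+4" 0 0 "2*k"]
      by (simp_all add: epsp_def epsq_def epsr_def rb_def)
  qed
  have p: "posq (epsp e)" "posq (epsq e)" "posq (epsr e)" if "e \<in> signs" for e
  proof -
    have n: "4 * of_int n = sa * sa + sb * sb" "rb = (sa * sa + sc * sc) / 2"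
      "4 * of_int n + 4 = sb * sb + sc * sc" by (simp_all add: s_sq ra_def rb_def rc_def)
    \<comment> \<open>Each unit is a positive multiple of a square in the larger field generated by
      \<open>sa, sb, sc\<close>, so all its conjugates are positive.\<close>
    have "emb e' f' (epsp e) = (sb + e * e' * sa)^2 / 2 \<and> emb e' f' (epsq e) = (sc + e * f' * sa)^2 / 4
      \<and> emb e' f' (epsr e) = (sc + e * e' * f' * sb)^2 / 2" if "e' \<in> signs" "f' \<in> signs" for e' f'
      using that \<open>e \<in> signs\<close> unfolding epsp_def epsq_def epsr_def n(2,3) unfolding n(1)
      by (auto simp: signs_def sp_def sq_def sr_def power2_eq_square field_simps)
    moreover have "sb + e * e' * sa > 0 \<and> sc + e * f' * sa > 0 \<and> sc + e * e' * f' * sb > 0"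
      if "e' \<in> signs" "f' \<in> signs" for e' f'
      using that \<open>e \<in> signs\<close> s by (auto simp: signs_def)
    ultimately have "0 < emb e' f' (epsp e) \<and> 0 < emb e' f' (epsq e) \<and> 0 < emb e' f' (epsr e)"
      if "e' \<in> signs" "f' \<in> signs" for e' f'
      using that by (simp only: zero_less_power divide_pos_pos zero_less_numeral)
    then show "posq (epsp e)" "posq (epsq e)" "posq (epsr e)" by (simp_all add: posq_def)
  qed
  have m: "mulq (epsp e) (epsp (- e)) = (2, 0, 0, 0)" "mulq (epsq e) (epsq (- e)) = (2, 0, 0, 0)"
    "mulq (epsr e) (epsr (- e)) = (2, 0, 0, 0)"
    using assms by (auto simp: signs_def epsp_def epsq_def epsr_def ra_def rb_def rc_def algebra_simps)
  show "unitq (epsp e)" "unitq (epsq e)" "unitq (epsr e)"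
    unfolding unitq_def using i[OF assms] p[OF assms] m i[OF signs_neg[OF assms]] p[OF signs_neg[OF assms]]
    by blast+
qed

lemma unit_mulq: assumes "unitq u" "unitq v" shows "unitq (mulq u v)"
proof -
  obtain u' v' where "intq u'" "posq u'" "mulq u u' = (2, 0, 0, 0)" "intq v'" "posq v'" "mulq v v' = (2, 0, 0, 0)"
    using assms by (auto simp: unitq_def)
  moreover from this have "mulq (mulq u v) (mulq u' v') = (2, 0, 0, 0)"
    by (metis mulq_assoc mulq_comm mulq_one)
  ultimately show ?thesis using assms unfolding unitq_def by (meson intq_mulq posq_mulq)
qed

lemma unit_one: "unitq (2, 0, 0, 0)"
  using unit_mulq[OF unit_eps(1)[of 1] unit_eps(1)[of "-1"]]
  by (simp add: signs_def epsp_def ra_def rb_def algebra_simps)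

text \<open>All conjugates of \<rho> are associates, and \<rho> squared is 2 up to a unit. In the
  factorization of \<open>rho\<close>, equal factors multiply to squares, that is 4
  \<open>epsq\<close> or 2 \<open>epsr\<close>; opposite ones give \<open>rc - ra = 4\<close> or
  \<open>rc - rb = 2\<close>. The quadruple \<open>(4, 0, 0, 0)\<close> stands for 2.\<close>

lemma rho_rho:
  assumes "e \<in> signs" "f \<in> signs" "e' \<in> signs" "f' \<in> signs"
  shows "\<exists>u. unitq u \<and> mulq (rho e f) (rho e' f') = mulq (4, 0, 0, 0) u"
proof -
  define u where "u = mulq (if f' = f then epsq f else (2, 0, 0, 0))
    (if e' * f' = e * f then epsr (- (e * f)) else (2, 0, 0, 0))"
  have "unitq u" unfolding u_def using assms
    by (auto intro!: unit_mulq unit_eps unit_one signs_neg signs_mult)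
  moreover have "mulq (rho e f) (rho e' f') = mulq (4, 0, 0, 0) u"
    using assms by (auto simp: signs_def u_def rho_def epsq_def epsr_def ra_def rb_def rc_def field_simps)
  ultimately show ?thesis by blast
qed

text \<open>Every vertex of the second facet is divisible by every conjugate of \<rho>, so a vertex
  subtracted from a multiple of \<rho> can be divided out again. For \<open>g = f\<close> the
  quotient is \<open>(sb + h * sa) * (sc + e * f * sb) / 2\<close>; the other sign costs the unit
  \<open>epsq (- f)\<close>.\<close>

lemma rho_vert:
  assumes "e \<in> signs" "f \<in> signs" "g \<in> signs" "h \<in> signs"
  shows "\<exists>v. intq v \<and> mulq (rho e f) v = vert g h"
proof -
  obtain k l m where klm: "e = of_int k" "odd k" "f = of_int l" "odd l" "h = of_int m" "odd m"
    using assms signs_int by meson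
  define v :: quad where "v = (e * f * rb, h * e * f, h, 1)"
  have "intq v" using intqI[of "k*l*(2*n+1)" m "m*k*l" 1] klm by (simp add: v_def rb_def)
  moreover have "intq (epsq (- f))" using unit_eps(2)[OF signs_neg[OF assms(2)]] by (simp add: unitq_def)
  ultimately have "intq (if g = f then v else mulq (epsq (- f)) v)" by (simp add: intq_mulq)
  moreover have "mulq (rho e f) (if g = f then v else mulq (epsq (- f)) v) = vert g h"
    using assms unfolding signs_def
    by (auto simp: v_def rho_def vert_def epsq_def ra_def rb_def rc_def field_simps)
  ultimately show ?thesis by blast
qed


section \<open>Descent to elements of minimal height\<close>

definition reducible :: "quad \<Rightarrow> bool" where
  "reducible x \<longleftrightarrow> splits x \<or> (\<exists>m. intq m \<and> posq m \<and> height (mulq m x) \<le> 2)"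

lemma splits_mulq:
  assumes "intq u" "posq u" "splits x" shows "splits (mulq u x)"
proof -
  obtain y z where yz: "intq y" "intq z" "twisted_pos y" "twisted_pos z" "x = y + z" using assms(3) unfolding splits_def by blast
  then have "mulq u x = mulq u y + mulq u z" by (simp add: mulq_add)
  then show ?thesis unfolding splits_def using yz assms(1,2)
    by (intro exI[of _ "mulq u y"] exI[of _ "mulq u z"]) (simp add: intq_mulq twisted_pos_mulq)
qed

text \<open>A splitting is carried back by the inverse unit, and a witness \<open>m\<close> is
  replaced by \<open>m u\<close>.\<close>

lemma reducible_unit:
  assumes "unitq u" "reducible (mulq u x)" shows "reducible x"
proof -
  obtain v where v: "intq v" "posq v" "mulq u v = (2, 0, 0, 0)" and u: "intq u" "posq u"
    using assms(1) unfolding unitq_def by blast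
  have x: "mulq v (mulq u x) = x" by (metis v(3) mulq_assoc mulq_comm mulq_one)
  from assms(2) consider "splits (mulq u x)" | m where "intq m" "posq m" "height (mulq m (mulq u x)) \<le> 2"
    unfolding reducible_def by blast
  then show ?thesis
  proof cases
    case 1
    then show ?thesis using splits_mulq[OF v(1,2)] x unfolding reducible_def by metis
  next
    case 2
    then have "intq (mulq m u)" "posq (mulq m u)" "height (mulq (mulq m u) x) \<le> 2"
      using u by (simp_all add: intq_mulq posq_mulq mulq_assoc)
    then show ?thesis unfolding reducible_def by blast
  qed
qed

lemma height_int: "intq x \<Longrightarrow> \<exists>k::int. height x = k"
  by (auto simp: intq_def)

text \<open>Since \<open>rc = ra + 4\<close>, bounds on the heights of multiples by \<rho> are
  bounds on the vertex coefficients.\<close>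

lemma height_rho: "height (mulq (rho e f) x) = 2 * height x + vert_coef f (- e) x / 2" if "e \<in> signs" "f \<in> signs"
  using that by (cases x) (auto simp: rho_def vert_coef_def signs_def rc_def ra_def field_simps)

lemma height_two: "height (mulq (4, 0, 0, 0) x) = 2 * height x"
  by (cases x) simp

text \<open>Multiplying \<open>y = \<rho> x\<close> by any conjugate of \<rho> gives 2 times a unit
  multiple of \<open>x\<close>, of height at least \<open>2 * height x > 2 * height y\<close>. By
  \<open>height_rho\<close> all vertex coefficients of \<open>y\<close> are then nonnegative, so
  \<open>y\<close> lies in the cone over the second facet; a vertex is subtracted there and the
  result divided by \<rho>.\<close>

lemma rho_reducible:
  assumes x: "intq x" "twisted_pos x" and e: "e \<in> signs" "f \<in> signs"
    and d: "height (mulq (rho e f) x) < height x"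
    and u: "\<And>u. unitq u \<Longrightarrow> height x \<le> height (mulq u x)"
  shows "reducible x"
proof (cases "height (mulq (rho e f) x) \<le> 2")
  case True
  then show ?thesis using intq_rho[OF e] posq_rho[OF e] unfolding reducible_def by blast
next
  case False
  define y where "y = mulq (rho e f) x"
  have y: "intq y" "twisted_pos y" unfolding y_def using x intq_rho posq_rho e by (auto intro: intq_mulq twisted_pos_mulq)
  have d3: "height y \<ge> 3" using False height_int[OF y(1)] by (auto simp: y_def[symmetric])
  have "0 \<le> vert_coef g h y" if gh: "g \<in> signs" "h \<in> signs" for g h
  proof -
    obtain v where v: "unitq v" "mulq (rho e f) (rho (- h) g) = mulq (4, 0, 0, 0) v"
      using rho_rho[OF e signs_neg[OF gh(2)] gh(1)] by blast
    have "mulq (rho (- h) g) y = mulq (mulq (rho e f) (rho (- h) g)) x"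
      unfolding y_def by (metis mulq_assoc mulq_comm)
    then have "height (mulq (rho (- h) g) y) = 2 * height (mulq v x)"
      unfolding v(2) mulq_assoc by (simp add: height_two)
    then show ?thesis using height_rho[OF signs_neg[OF gh(2)] gh(1), of y] u[OF v(1)] d by (simp add: y_def)
  qed
  then obtain g h where gh: "g \<in> signs" "h \<in> signs" "twisted_pos (y - vert g h)"
    using vert_coef_step[OF _ y(1) d3] by blast
  obtain v where v: "intq v" "mulq (rho e f) v = vert g h" using rho_vert[OF e gh(1,2)] by blast
  have "twisted_pos (vert g h)"
    by (rule vert_coef_twisted_pos) (use gh r_pos in \<open>auto simp: vert_coef_def vert_def signs_def\<close>)
  then have "twisted_pos v" using twisted_pos_mulq_cancel[OF posq_rho[OF e]] v(2) by simp
  moreover have "twisted_pos (x - v)"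
    using gh(3) twisted_pos_mulq_cancel[OF posq_rho[OF e], of "x - v"] by (simp add: mulq_diff v(2) y_def)
  ultimately show ?thesis using splitsI[OF x(1) v(1)] unfolding reducible_def by blast
qed

text \<open>Induction on the height: a non-reducible element cannot be lowered by a unit, by the
  induction hypothesis, nor by \<rho>, by \<open>rho_reducible\<close>. This minimality places it in
  the cone over the first facet, where it splits.\<close>

lemma twisted_pos_reducible:
  assumes "intq x" "twisted_pos x" shows "reducible x"
  using assms
proof (induction "nat \<lfloor>height x\<rfloor>" arbitrary: x rule: less_induct)
  case less
  note x = less.prems
  obtain A B C D :: int where xD: "x = (of_int A, of_int B, of_int C, of_int D)" and ev: "even (A - C)" "even (B - D)"
    using x by (auto simp: intq_def)
  show ?case
  proof (rule ccontr)
    assume nr: "\<not> reducible x"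
    have u: "height x \<le> height (mulq u x)" if "unitq u" for u
    proof (rule ccontr)
      assume "\<not> ?thesis"
      moreover have ux: "intq (mulq u x)" "twisted_pos (mulq u x)"
        using that x unfolding unitq_def by (auto intro: intq_mulq twisted_pos_mulq)
      moreover from ux(1) obtain k :: int where "height (mulq u x) = k" using height_int by blast
      ultimately have "nat \<lfloor>height (mulq u x)\<rfloor> < nat \<lfloor>height x\<rfloor>"
        using twisted_pos_height_pos[OF x(2)] by (simp add: xD)
      then have "reducible (mulq u x)" using less.hyps ux by blast
      then show False using nr reducible_unit[OF that] by blast
    qed
    have r: "height x \<le> height (mulq (rho e f) x)" if "e \<in> signs" "f \<in> signs" for e f
      using rho_reducible[OF x that _ u] nr by fastforce
    have D: "D \<ge> 3"
    proof -
      have "\<not> height (mulq (2, 0, 0, 0) x) \<le> 2" using nr unit_one unfolding reducible_def unitq_def by blast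
      then show ?thesis by (simp add: xD)
    qed
    obtain i where i: "D + B = 2 * i" using ev(2) by (metis dvd_def even_diff_iff add.commute)
    define j where "j = D - i"
    have ij: "B = i - j" "D = i + j" using i by (auto simp: j_def)
    have ra: "ra > 0" using r_pos by simp
    \<comment> \<open>Minimality yields every wall of the first cone: \<open>epsq\<close> and
      \<open>epsp\<close> bound \<open>B\<close> and \<open>C\<close>, their products give
      \<open>E\<close>, and \<open>rho\<close> gives \<open>F\<close>.\<close>
    have q: "height x \<le> height (mulq (epsq e) x)" "height x \<le> height (mulq (epsp e) x)" if "e \<in> signs" for e
      using u unit_eps that by blast+
    have pq: "height x \<le> height (mulq (mulq (epsp e) (epsq f)) x)" if "e \<in> signs" "f \<in> signs" for e f
      using u unit_eps unit_mulq that by blast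
    have B: "\<bar>real_of_int B\<bar> \<le> D"
    proof -
      have "0 \<le> ra * (D + B)" "0 \<le> ra * (D - B)"
        using q(1)[of 1] q(1)[of "-1"] by (simp_all add: signs_def xD epsq_def ra_def rb_def algebra_simps)
      then show ?thesis using ra by (simp add: zero_le_mult_iff)
    qed
    have C: "\<bar>real_of_int C\<bar> \<le> D"
    proof -
      have "0 \<le> ra * (D + C)" "0 \<le> ra * (D - C)"
        using q(2)[of 1] q(2)[of "-1"] by (simp_all add: signs_def xD epsp_def ra_def rb_def algebra_simps)
      then show ?thesis using ra by (simp add: zero_le_mult_iff)
    qed
    have E: "0 \<le> (2 * n + 2) * D + e * f * A + e * (2 * n + 1) * C + 2 * n * f * B"
      if "e \<in> signs" "f \<in> signs" for e f :: real
    proof -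
      have "2 * height (mulq (mulq (epsp e) (epsq f)) x) - 2 * height x =
          ra * ((2 * n + 2) * D + e * f * A + e * (2 * n + 1) * C + 2 * n * f * B)"
        by (simp add: xD epsp_def epsq_def ra_def rb_def field_simps)
      then have "0 \<le> ra * ((2 * n + 2) * D + e * f * A + e * (2 * n + 1) * C + 2 * n * f * B)"
        using pq[OF that] by simp
      then show ?thesis using ra by (simp add: zero_le_mult_iff)
    qed
    have F: "0 \<le> (2 * n + 1) * D + f * g * A + f * (2 * n - 1) * B + g * (2 * n - 1) * C"
      if "g \<in> signs" "f \<in> signs" for f g :: real
    proof -
      have "0 \<le> 2 * height x + vert_coef f g x"
        using r[OF signs_neg[OF that(1)] that(2)] height_rho[OF signs_neg[OF that(1)] that(2), of x] by simp
      then show ?thesis by (simp add: xD vert_coef_def ra_def algebra_simps)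
    qed
    note E' = E[of 1 1] E[of 1 "-1"] E[of "-1" 1] E[of "-1" "-1"]
    note F' = F[of 1 1] F[of 1 "-1"] F[of "-1" 1] F[of "-1" "-1"]
    have ij0: "i \<ge> 0" "j \<ge> 0" using B by (auto simp: ij)
    have "\<exists>Z. in_facet_cone A C i j Z"
    proof (rule walls_facet_cone)
      show "\<bar>real_of_int C\<bar> \<le> real_of_int i + real_of_int j" using C by (simp add: ij)
      show "\<bar>A - (2 * real_of_int n - 1) * C\<bar> \<le> 2 * real_of_int i + 4 * real_of_int n * j"
        "\<bar>A + (2 * real_of_int n - 1) * C\<bar> \<le> 2 * real_of_int j + 4 * real_of_int n * i"
        using F' by (simp_all add: signs_def ij abs_le_iff algebra_simps)
      show "\<bar>A - (2 * real_of_int n + 1) * C\<bar> \<le> 2 * real_of_int i + (4 * real_of_int n + 2) * j"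
        "\<bar>A + (2 * real_of_int n + 1) * C\<bar> \<le> 2 * real_of_int j + (4 * real_of_int n + 2) * i"
        using E' by (simp_all add: signs_def ij abs_le_iff algebra_simps)
    qed (use ij0 in auto)
    then obtain Z where "in_facet_cone A C i j Z" ..
    then have "splits (real_of_int A, real_of_int i - real_of_int j, real_of_int C, real_of_int i + real_of_int j)"
      by (rule facet_cone_splits) (use ij0 D x(1) in \<open>auto simp: xD ij\<close>)
    then show False using nr unfolding reducible_def by (simp add: xD ij)
  qed
qed

section \<open>The field, its embeddings and its trace\<close>

definition ratq :: "quad \<Rightarrow> bool" where
  "ratq x \<longleftrightarrow> (\<exists>A\<in>\<rat>. \<exists>B\<in>\<rat>. \<exists>C\<in>\<rat>. \<exists>D\<in>\<rat>. x = (A, B, C, D))"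

lemma ratq_iff: "ratq (A, B, C, D) \<longleftrightarrow> A \<in> \<rat> \<and> B \<in> \<rat> \<and> C \<in> \<rat> \<and> D \<in> \<rat>"
  by (auto simp: ratq_def)

lemma r_Rats: "ra \<in> \<rat>" "rb \<in> \<rat>" "rc \<in> \<rat>"
  by (auto simp: ra_def rb_def rc_def)

lemma ratq_mulq: "ratq x \<Longrightarrow> ratq y \<Longrightarrow> ratq (mulq x y)"
  by (cases x; cases y) (auto simp: ratq_iff r_Rats)

lemma ratq_add: "ratq x \<Longrightarrow> ratq y \<Longrightarrow> ratq (x + y)"
  by (cases x; cases y) (auto simp: ratq_iff)

lemma ratq_diff: "ratq x \<Longrightarrow> ratq y \<Longrightarrow> ratq (x - y)"
  by (cases x; cases y) (auto simp: ratq_iff)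

lemma intq_ratq: "intq x \<Longrightarrow> ratq x"
  by (auto simp: intq_def ratq_iff)

lemma s_products:
  "sp * sp = ra * rb" "sq * sq = ra * rc" "sr * sr = rb * rc"
  "sp * sq = ra * sr" "sp * sr = rb * sq" "sq * sr = rc * sp"
  unfolding sp_def sq_def sr_def s_sq[symmetric] by (simp_all add: mult_ac)

lemma s_irrational: "sp \<notin> \<rat>" "sq \<notin> \<rat>" "sr \<notin> \<rat>"
proof -
  define N :: real where "N = of_int n"
  have N: "N \<ge> 1" using n_pos by (simp add: N_def)
  have p0: "sp > 0" "sq > 0" "sr > 0" using s_pos by (simp_all add: sp_def sq_def sr_def)
  have p2: "sp^2 = 4 * N^2 - 1" "sq^2 = 4 * N^2 + 4 * N - 3" "sr^2 = 4 * N^2 + 8 * N + 3"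
    by (simp_all add: power2_eq_square s_products ra_def rb_def rc_def N_def algebra_simps)
  have "2 * N - 1 < sp" "2 * N < sq" "2 * N + 1 < sr"
    by (rule power2_less_imp_less; use p0 p2 N in \<open>simp add: power2_eq_square algebra_simps\<close>)+
  moreover have "sp < 2 * N" "sq < 2 * N + 1" "sr < 2 * N + 2"
    by (rule power2_less_imp_less; use p0 p2 N in \<open>simp add: power2_eq_square algebra_simps\<close>)+
  ultimately show "sp \<notin> \<rat>" "sq \<notin> \<rat>" "sr \<notin> \<rat>"
    using irrational_between[of sp "4 * n^2 - 1" "2 * n - 1"]
      irrational_between[of sq "4 * n^2 + 4 * n - 3" "2 * n"]
      irrational_between[of sr "4 * n^2 + 8 * n + 3" "2 * n + 1"]
    by (simp_all add: p2 N_def)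
qed

text \<open>Linear independence of 1, \<surd>p, \<surd>q, \<surd>r over the rationals: the product
  with a conjugate lies in a quadratic subfield, so its rational part vanishes. The three relations
  combine to \<open>A^2 = p B^2 = q C^2 = r D^2\<close>.\<close>

lemma emb_eq_0:
  assumes "ratq x" "emb 1 1 x = 0" shows "x = 0"
proof -
  obtain A B C D where x: "x = (A, B, C, D)" by (cases x)
  have Q: "A \<in> \<rat>" "B \<in> \<rat>" "C \<in> \<rat>" "D \<in> \<rat>" using assms by (auto simp: x ratq_iff)
  have 0: "A + B * sp + C * sq + D * sr = 0" using assms by (simp add: x)
  have "(A^2 + ra * rb * B^2 - ra * rc * C^2 - rb * rc * D^2) + (2 * A * B - 2 * rc * C * D) * sp
    = (A + B * sp + C * sq + D * sr) * (A + B * sp - C * sq - D * sr)"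
    (is "?H1 = _")
    by (simp add: sp_def sq_def sr_def s_sq[symmetric] power2_eq_square algebra_simps)
  also have "\<dots> = 0" using 0 by simp
  finally have h1: "?H1 = 0" .
  have 1: "A^2 + ra * rb * B^2 - ra * rc * C^2 - rb * rc * D^2 = 0"
    using irrational_lin_indep[OF s_irrational(1) _ _ h1] Q r_Rats by simp
  have "(A^2 - ra * rb * B^2 + ra * rc * C^2 - rb * rc * D^2) + (2 * A * C - 2 * rb * B * D) * sq
    = (A + B * sp + C * sq + D * sr) * (A - B * sp + C * sq - D * sr)"
    (is "?H2 = _")
    by (simp add: sp_def sq_def sr_def s_sq[symmetric] power2_eq_square algebra_simps)
  also have "\<dots> = 0" using 0 by simp
  finally have h2: "?H2 = 0" .
  have 2: "A^2 - ra * rb * B^2 + ra * rc * C^2 - rb * rc * D^2 = 0"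
    using irrational_lin_indep[OF s_irrational(2) _ _ h2] Q r_Rats by simp
  have "(A^2 - ra * rb * B^2 - ra * rc * C^2 + rb * rc * D^2) + (2 * A * D - 2 * ra * B * C) * sr
    = (A + B * sp + C * sq + D * sr) * (A - B * sp - C * sq + D * sr)"
    (is "?H3 = _")
    by (simp add: sp_def sq_def sr_def s_sq[symmetric] power2_eq_square algebra_simps)
  also have "\<dots> = 0" using 0 by simp
  finally have h3: "?H3 = 0" .
  have 3: "A^2 - ra * rb * B^2 - ra * rc * C^2 + rb * rc * D^2 = 0"
    using irrational_lin_indep[OF s_irrational(3) _ _ h3] Q r_Rats by simp
  have eq: "A = 0 \<and> y = 0" if "A^2 = s^2 * y^2" "s \<notin> \<rat>" "y \<in> \<rat>" for s y
  proof -
    have "(A - s * y) * (A + s * y) = 0" using that(1) by (simp add: algebra_simps power2_eq_square)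
    then have "A + (- y) * s = 0 \<or> A + y * s = 0" unfolding mult_eq_0_iff by (simp add: mult.commute)
    then show ?thesis
    proof
      assume "A + (- y) * s = 0"
      then have "A = 0 \<and> - y = 0" using that(3) by (intro irrational_lin_indep[OF that(2) Q(1)]) simp_all
      then show ?thesis by simp
    next
      assume "A + y * s = 0"
      then show ?thesis by (rule irrational_lin_indep[OF that(2) Q(1) that(3)])
    qed
  qed
  have h: "A^2 = sp^2 * B^2" "A^2 = sq^2 * C^2" "A^2 = sr^2 * D^2"
    using 1 2 3 unfolding power2_eq_square[of sp] power2_eq_square[of sq] power2_eq_square[of sr] s_products
    by linarith+
  show ?thesis
    using eq[OF h(1) s_irrational(1) Q(2)] eq[OF h(2) s_irrational(2) Q(3)] eq[OF h(3) s_irrational(3) Q(4)]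
    by (simp add: x zero_prod_def)
qed

lemma emb_inj: "ratq x \<Longrightarrow> ratq y \<Longrightarrow> emb 1 1 x = emb 1 1 y \<Longrightarrow> x = y"
  using emb_eq_0[of "x - y"] ratq_diff[of x y] by (simp add: emb_diff)

fun cjq :: "real \<Rightarrow> real \<Rightarrow> quad \<Rightarrow> quad" where
  "cjq e f (A, B, C, D) = (A, e * B, f * C, e * f * D)"

lemma emb_cjq: "emb e f (cjq e' f' x) = emb (e * e') (f * f') x"
  by (cases x) (simp add: mult_ac)

lemma ratq_cjq: "e \<in> signs \<Longrightarrow> f \<in> signs \<Longrightarrow> ratq x \<Longrightarrow> ratq (cjq e f x)"
  by (cases x) (auto simp: ratq_iff signs_def)

lemma emb_eq_0': "e \<in> signs \<Longrightarrow> f \<in> signs \<Longrightarrow> ratq x \<Longrightarrow> emb e f x = 0 \<Longrightarrow> x = 0"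
  using emb_eq_0[OF ratq_cjq[of e f x]] emb_cjq[of 1 1 e f x]
  by (cases x) (simp add: signs_def zero_prod_def, fastforce)

text \<open>Relative norms in two steps: \<open>m\<close> lies in the subfield generated by
  \<surd>q, and \<open>mulq m d\<close> is rational.\<close>

lemma ratq_inverse:
  assumes "ratq x" "x \<noteq> 0"
  shows "\<exists>y. ratq y \<and> mulq x y = (2, 0, 0, 0)"
proof -
  define c where "c = cjq (-1) 1 x"
  define m where "m = mulq x c"
  define d where "d = cjq 1 (-1) m"
  have c: "ratq c" using assms by (simp add: c_def ratq_cjq signs_def)
  have m: "ratq m" using assms c by (simp add: m_def ratq_mulq)
  have d: "ratq d" using m by (simp add: d_def ratq_cjq signs_def)
  have "m = (fst m, 0, fst (snd (snd m)), 0)"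
    by (cases x) (simp add: m_def c_def mult.commute)
  then obtain u v where m_eq: "m = (u, 0, v, 0)" by blast
  define t where "t = fst (mulq m d)"
  have t: "mulq m d = (t, 0, 0, 0)" by (simp add: t_def d_def m_eq)
  have tQ: "t \<in> \<rat>" using ratq_mulq[OF m d] by (simp add: t ratq_iff)
  have ne: "emb e f x \<noteq> 0" if "e \<in> signs" "f \<in> signs" for e f
    using emb_eq_0' that assms by blast
  have "emb 1 1 (mulq m d) = emb 1 1 x * emb (-1) 1 x * (emb 1 (-1) x * emb (-1) (-1) x)"
    by (simp add: emb_mulq m_def c_def d_def emb_cjq signs_def)
  also have "\<dots> \<noteq> 0" using ne by (simp add: signs_def)
  finally have t0: "t \<noteq> 0" by (simp add: t)
  \<comment> \<open>The norm is \<open>t / 2\<close>, so its inverse \<open>2 / t\<close> has first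
    coordinate \<open>4 / t\<close>.\<close>
  have "mulq x (mulq (mulq c d) (4 / t, 0, 0, 0)) = mulq (mulq m d) (4 / t, 0, 0, 0)"
    by (simp add: m_def mulq_assoc)
  also have "\<dots> = (2, 0, 0, 0)" using t0 by (simp add: t)
  finally show ?thesis using c d tQ
    by (intro exI[of _ "mulq (mulq c d) (4 / t, 0, 0, 0)"]) (simp add: ratq_mulq ratq_iff del: mulq.simps)
qed

definition KK :: "real set" where "KK = emb 1 1 ` {x. ratq x}"

lemma KK_I: "ratq x \<Longrightarrow> emb 1 1 x \<in> KK" by (auto simp: KK_def)

lemma KK_E: "y \<in> KK \<Longrightarrow> \<exists>x. ratq x \<and> y = emb 1 1 x" unfolding KK_def by blast

lemma Rats_KK: "x \<in> \<rat> \<Longrightarrow> x \<in> KK"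
  using KK_I[of "(2 * x, 0, 0, 0)"] by (simp add: ratq_iff)

lemma s_KK: "sp \<in> KK" "sq \<in> KK" "sr \<in> KK"
  using KK_I[of "(0, 2, 0, 0)"] KK_I[of "(0, 0, 2, 0)"] KK_I[of "(0, 0, 0, 2)"] by (simp_all add: ratq_iff)

lemma one_signs: "1 \<in> signs" "-1 \<in> signs" by (auto simp: signs_def)

lemma KK_add: "x \<in> KK \<Longrightarrow> y \<in> KK \<Longrightarrow> x + y \<in> KK"
proof -
  assume "x \<in> KK" "y \<in> KK"
  then obtain u v where "ratq u" "x = emb 1 1 u" "ratq v" "y = emb 1 1 v" using KK_E by meson
  then show ?thesis using KK_I[of "u + v"] by (simp add: ratq_add emb_add)
qed

lemma KK_mult: "x \<in> KK \<Longrightarrow> y \<in> KK \<Longrightarrow> x * y \<in> KK"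
proof -
  assume "x \<in> KK" "y \<in> KK"
  then obtain u v where "ratq u" "x = emb 1 1 u" "ratq v" "y = emb 1 1 v" using KK_E by meson
  then show ?thesis using KK_I[of "mulq u v"] by (simp add: ratq_mulq emb_mulq one_signs)
qed

lemma subfield_KK: "subfield_of_type KK"
proof -
  have inv: "inverse x \<in> KK" if "x \<in> KK" for x
  proof (cases "x = 0")
    case True then show ?thesis using Rats_KK[of 0] by simp
  next
    case False
    obtain u where u: "ratq u" "x = emb 1 1 u" using KK_E \<open>x \<in> KK\<close> by blast
    then have "u \<noteq> 0" using False by (auto simp: zero_prod_def)
    then obtain v where v: "ratq v" "mulq u v = (2, 0, 0, 0)" using ratq_inverse u by blast
    then have "x * emb 1 1 v = 1" using emb_mulq[OF one_signs(1) one_signs(1), of u v] u by simp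
    then have "inverse x = emb 1 1 v" by (metis inverse_unique)
    then show ?thesis using KK_I v by simp
  qed
  have "- x \<in> KK" if "x \<in> KK" for x using KK_mult[OF Rats_KK[of "-1"] that] by simp
  then show ?thesis unfolding subfield_of_type_def using inv KK_add KK_mult Rats_KK by auto
qed

lemma rat_adjoin_KK: "rat_adjoin {sp, sq} = KK"
proof
  show "rat_adjoin {sp, sq} \<subseteq> KK"
    unfolding rat_adjoin_def using subfield_KK s_KK by auto
  show "KK \<subseteq> rat_adjoin {sp, sq}"
    unfolding rat_adjoin_def
  proof (intro Inter_greatest, elim CollectE conjE)
    fix F assume F: "subfield_of_type F" "{sp, sq} \<subseteq> F"
    have add: "x + y \<in> F" and mult: "x * y \<in> F" if "x \<in> F" "y \<in> F" for x y
      using F(1) that by (auto simp: subfield_of_type_def)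
    have Q: "x \<in> F" if "x \<in> \<rat>" for x using subfield_Rats[OF F(1)] that by auto
    have "sr = (1 / ra) * (sp * sq)" using r_pos by (simp add: s_products)
    then have "sr \<in> F" using mult[OF Q[of "1 / ra"] mult[of sp sq]] F(2) r_Rats by simp
    then have "emb 1 1 x \<in> F" if "ratq x" for x
    proof (cases x)
      case (fields A B C D)
      then have "A \<in> F" "B \<in> F" "C \<in> F" "D \<in> F" "inverse 2 \<in> F" using that Q by (auto simp: ratq_iff)
      then have "(A + B * sp + C * sq + D * sr) * inverse 2 \<in> F"
        using \<open>sr \<in> F\<close> F(2) by (intro add mult) auto
      then show ?thesis by (simp add: fields)
    qed
    then show "KK \<subseteq> F" by (auto simp: KK_def)
  qed
qed

definition coords :: "real \<Rightarrow> quad" where "coords y = (THE x. ratq x \<and> emb 1 1 x = y)"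

lemma coords_emb: "ratq x \<Longrightarrow> coords (emb 1 1 x) = x"
  unfolding coords_def by (rule the_equality) (use emb_inj in blast)+

text \<open>The target type is generic because total positivity uses real embeddings and the trace
  complex ones.\<close>

definition sig :: "real \<Rightarrow> real \<Rightarrow> real \<Rightarrow> 'b :: real_field" where
  "sig e f = restrict (\<lambda>y. of_real (emb e f (coords y))) KK"

lemma sig_emb: "ratq x \<Longrightarrow> sig e f (emb 1 1 x) = of_real (emb e f x)"
  using KK_I[of x] by (simp add: sig_def coords_emb)

lemma sig_embedding:
  assumes "e \<in> signs" "f \<in> signs" shows "(sig e f :: real \<Rightarrow> 'b :: real_field) \<in> field_embeddings KK"
proof -
  have "sig e f (u + v) = sig e f u + (sig e f v :: 'b) \<and> sig e f (u * v) = sig e f u * (sig e f v :: 'b)"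
    if uv: "u \<in> KK" "v \<in> KK" for u v
  proof -
    obtain x y where xy: "ratq x" "ratq y" "u = emb 1 1 x" "v = emb 1 1 y" using KK_E[OF uv(1)] KK_E[OF uv(2)] by blast
    have eq: "u + v = emb 1 1 (x + y)" "u * v = emb 1 1 (mulq x y)"
      using xy by (simp_all add: emb_add emb_mulq one_signs)
    have "sig e f (u + v) = (of_real (emb e f (x + y)) :: 'b)"
      "sig e f (u * v) = (of_real (emb e f (mulq x y)) :: 'b)"
      unfolding eq using xy by (simp_all only: sig_emb ratq_add ratq_mulq)
    then show ?thesis using xy assms by (simp add: sig_emb emb_add emb_mulq)
  qed
  moreover have "sig e f 1 = (1 :: 'b)" using sig_emb[of "(2, 0, 0, 0)" e f] by (simp add: ratq_iff)
  moreover have "sig e f \<in> extensional KK" by (simp add: sig_def)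
  ultimately show ?thesis by (simp add: field_embeddings_def)
qed

text \<open>An embedding fixes the rationals, hence sends \<surd>p and \<surd>q to themselves up to
  sign; the image of \<surd>r is then forced by a \<surd>r = \<surd>p \<surd>q.\<close>

lemma embedding_sig:
  fixes \<sigma> :: "real \<Rightarrow> 'b :: real_field"
  assumes s: "\<sigma> \<in> field_embeddings KK"
  shows "\<exists>e\<in>signs. \<exists>f\<in>signs. \<sigma> = sig e f"
proof -
  have add: "\<sigma> (u + v) = \<sigma> u + \<sigma> v" and mult: "\<sigma> (u * v) = \<sigma> u * \<sigma> v" if "u \<in> KK" "v \<in> KK" for u v
    using s that by (auto simp: field_embeddings_def)
  have Q: "\<sigma> x = of_real x" if "x \<in> \<rat>" for x by (rule embedding_Rats[OF subfield_KK s that])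
  have root: "\<exists>e\<in>signs. \<sigma> t = of_real (e * t)" if "t \<in> KK" "t * t \<in> \<rat>" for t
  proof -
    have "\<sigma> t * \<sigma> t = of_real t * of_real t" using mult[OF that(1,1)] Q[OF that(2)] by simp
    then have "\<sigma> t = of_real t \<or> \<sigma> t = - of_real t" by (simp add: square_eq_iff)
    then show ?thesis by (auto simp: signs_def)
  qed
  have pq: "sp * sp \<in> \<rat>" "sq * sq \<in> \<rat>" unfolding s_products using r_Rats by auto
  obtain e where e: "e \<in> signs" "\<sigma> sp = of_real (e * sp)" using root[OF s_KK(1) pq(1)] by blast
  obtain f where f: "f \<in> signs" "\<sigma> sq = of_real (f * sq)" using root[OF s_KK(2) pq(2)] by blast
  have "of_real ra * \<sigma> sr = \<sigma> (ra * sr)" using mult[OF Rats_KK s_KK(3), of ra] Q r_Rats by simp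
  also have "\<dots> = \<sigma> (sp * sq)" by (simp add: s_products)
  also have "\<dots> = of_real (e * f * (sp * sq))" using mult[OF s_KK(1,2)] e f by simp
  also have "\<dots> = of_real ra * of_real (e * f * sr)" by (simp add: s_products)
  finally have sr: "\<sigma> sr = of_real (e * f * sr)" using r_pos by simp
  have "\<sigma> (emb 1 1 x) = sig e f (emb 1 1 x)" if x: "ratq x" for x
  proof (cases x)
    case (fields A B C D)
    have R: "A / 2 \<in> \<rat>" "B / 2 \<in> \<rat>" "C / 2 \<in> \<rat>" "D / 2 \<in> \<rat>" using x by (auto simp: fields ratq_iff)
    have m: "\<sigma> (y * s) = of_real y * \<sigma> s" "y * s \<in> KK" if "y \<in> \<rat>" "s \<in> KK" for y s
      using mult[OF Rats_KK[OF that(1)] that(2)] Q[OF that(1)] KK_mult[OF Rats_KK[OF that(1)] that(2)] by auto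
    have "emb 1 1 x = A / 2 + B / 2 * sp + C / 2 * sq + D / 2 * sr" by (simp add: fields add_divide_distrib)
    then have "\<sigma> (emb 1 1 x) = of_real (A / 2) + of_real (B / 2) * of_real (e * sp)
        + of_real (C / 2) * of_real (f * sq) + of_real (D / 2) * of_real (e * f * sr)"
      using R by (simp only: add m KK_add Rats_KK s_KK Q e f sr)
    also have "\<dots> = of_real (emb e f x)" by (simp add: fields field_simps)
    finally show ?thesis by (simp add: sig_emb x)
  qed
  then have "\<sigma> y = sig e f y" if "y \<in> KK" for y using KK_E[OF that] by blast
  moreover have "\<sigma> y = sig e f y" if "y \<notin> KK" for y
    using that s by (simp add: field_embeddings_def sig_def extensional_def)
  ultimately have "\<sigma> = sig e f" by blast
  then show ?thesis using e f by blast
qed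

lemma field_embeddings_KK: "field_embeddings KK = (\<lambda>(e, f). sig e f) ` (signs \<times> signs)"
  using sig_embedding embedding_sig by fast

lemma sig_inj: "inj_on (\<lambda>(e, f). sig e f :: real \<Rightarrow> 'b :: real_field) (signs \<times> signs)"
proof (rule inj_onI, clarify)
  fix e f e' f' assume s: "e \<in> signs" "f \<in> signs" "e' \<in> signs" "f' \<in> signs"
    and eq: "sig e f = (sig e' f' :: real \<Rightarrow> 'b)"
  have "sp > 0" "sq > 0" using s_pos by (simp_all add: sp_def sq_def)
  moreover have "of_real (emb e f x) = (of_real (emb e' f' x) :: 'b)" if "ratq x" for x
    using fun_cong[OF eq, of "emb 1 1 x"] unfolding sig_emb[OF that] .
  from this[of "(0, 2, 0, 0)"] this[of "(0, 0, 2, 0)"]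
  have "e * sp = e' * sp" "f * sq = f' * sq" by (simp_all add: ratq_iff)
  ultimately show "e = e' \<and> f = f'" by simp
qed

lemma totally_positive_emb: "ratq x \<Longrightarrow> totally_positive KK (emb 1 1 x) \<longleftrightarrow> posq x"
  unfolding totally_positive_def field_embeddings_KK posq_def by (auto simp: sig_emb)

text \<open>The irrational parts cancel over the four sign choices, and \<open>A / 2\<close> is
  counted four times.\<close>

lemma field_trace_emb:
  assumes "ratq x" shows "real_of_rat (field_trace KK (emb 1 1 x)) = 2 * fst x"
proof -
  have "(\<Sum>\<sigma>\<in>field_embeddings KK. \<sigma> (emb 1 1 x) :: complex) = (\<Sum>(e, f)\<in>signs \<times> signs. of_real (emb e f x))"
    unfolding field_embeddings_KK sum.reindex[OF sig_inj] by (rule sum.cong) (auto simp: sig_emb assms)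
  also have "\<dots> = of_real (2 * fst x)"
    by (cases x) (simp add: signs_def sum.cartesian_product[symmetric] field_simps)
  finally have sum: "(\<Sum>\<sigma>\<in>field_embeddings KK. \<sigma> (emb 1 1 x) :: complex) = of_real (2 * fst x)" .
  have "2 * fst x \<in> \<rat>" using assms by (cases x) (simp add: ratq_iff)
  then obtain t where t: "2 * fst x = real_of_rat t" by (rule Rats_cases)
  have "complex_of_real (real_of_rat t) = of_rat t" by (cases t) (simp add: of_rat_rat)
  then have "field_trace KK (emb 1 1 x) = t"
    unfolding field_trace_def sum t by (intro the_equality) simp_all
  then show ?thesis by (simp add: t)
qed

section \<open>The ring of integers\<close>

definition ordq :: "quad \<Rightarrow> bool" where
  "ordq x \<longleftrightarrow> (\<exists>a b c d :: int. x = (2 * of_int a, 2 * of_int b, 2 * of_int c, 2 * of_int d))"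

definition Ord :: "real set" where "Ord = emb 1 1 ` {x. ordq x}"

lemma OrdI: "ordq x \<Longrightarrow> emb 1 1 x \<in> Ord" by (auto simp: Ord_def)

lemma OrdE: "y \<in> Ord \<Longrightarrow> \<exists>x. ordq x \<and> y = emb 1 1 x" unfolding Ord_def by blast

lemma ordq_ratq: "ordq x \<Longrightarrow> ratq x" by (auto simp: ordq_def ratq_iff)

lemma ordq_add: "ordq x \<Longrightarrow> ordq y \<Longrightarrow> ordq (x + y)"
  unfolding ordq_def by (elim exE, simp only: add_Pair flip: distrib_left of_int_add) blast

lemma ordq_mulq: assumes "ordq x" "ordq y" shows "ordq (mulq x y)"
proof -
  obtain a b c d where x: "x = (2 * real_of_int a, 2 * real_of_int b, 2 * real_of_int c, 2 * real_of_int d)"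
    using assms(1) by (auto simp: ordq_def)
  obtain a' b' c' d' where y: "y = (2 * real_of_int a', 2 * real_of_int b', 2 * real_of_int c', 2 * real_of_int d')"
    using assms(2) by (auto simp: ordq_def)
  have "mulq x y =
    (2 * of_int (a*a' + (2*n-1)*(2*n+1)*b*b' + (2*n-1)*(2*n+3)*c*c' + (2*n+1)*(2*n+3)*d*d'),
     2 * of_int (a*b' + b*a' + (2*n+3)*(c*d' + d*c')),
     2 * of_int (a*c' + c*a' + (2*n+1)*(b*d' + d*b')),
     2 * of_int (a*d' + d*a' + (2*n-1)*(b*c' + c*b')))"
    by (simp add: x y ra_def rb_def rc_def field_simps)
  then show ?thesis unfolding ordq_def by blast
qed

lemma Ord_add: assumes "x \<in> Ord" "y \<in> Ord" shows "x + y \<in> Ord"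
proof -
  obtain u v where "ordq u" "x = emb 1 1 u" "ordq v" "y = emb 1 1 v" using OrdE[OF assms(1)] OrdE[OF assms(2)] by blast
  then show ?thesis using OrdI[OF ordq_add, of u v] by (simp add: emb_add)
qed

lemma Ord_mult: assumes "x \<in> Ord" "y \<in> Ord" shows "x * y \<in> Ord"
proof -
  obtain u v where "ordq u" "x = emb 1 1 u" "ordq v" "y = emb 1 1 v" using OrdE[OF assms(1)] OrdE[OF assms(2)] by blast
  then show ?thesis using OrdI[OF ordq_mulq, of u v] by (simp add: emb_mulq one_signs)
qed

lemma Ord_of_int: "of_int k \<in> Ord"
  using OrdI[of "(2 * of_int k, 2 * of_int 0, 2 * of_int 0, 2 * of_int 0)"] unfolding ordq_def by fastforce

lemma Ord_Ints: "x \<in> \<int> \<Longrightarrow> x \<in> Ord"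
  using Ord_of_int by (auto elim: Ints_cases)

lemma Ord_sum: "(\<And>i. i \<in> I \<Longrightarrow> g i \<in> Ord) \<Longrightarrow> sum g I \<in> Ord"
  by (induction I rule: infinite_finite_induct) (use Ord_of_int[of 0] in \<open>auto intro: Ord_add\<close>)

lemma Ord_Rats: assumes "x \<in> Ord" "x \<in> \<rat>" shows "x \<in> \<int>"
proof -
  obtain u where u: "ordq u" "x = emb 1 1 u" using OrdE assms by blast
  have "u = (2 * x, 0, 0, 0)"
    by (rule emb_inj) (use u assms ordq_ratq in \<open>auto simp: ratq_iff\<close>)
  then show ?thesis using u(1) by (auto simp: ordq_def)
qed

lemma KK_denominator: assumes "y \<in> KK" shows "\<exists>d::nat. d > 0 \<and> of_nat d * y \<in> Ord"
proof -
  obtain A B C D where x: "A \<in> \<rat>" "B \<in> \<rat>" "C \<in> \<rat>" "D \<in> \<rat>" "y = emb 1 1 (A, B, C, D)"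
    using KK_E[OF assms] by (auto simp: ratq_def)
  have den: "\<exists>k::nat. k > 0 \<and> of_nat k * z \<in> \<int>" if "z \<in> \<rat>" for z :: real
  proof -
    obtain a b where "b > 0" "z = of_int a / of_int b" using \<open>z \<in> \<rat>\<close> by (metis Rats_cases')
    then have "of_nat (nat b) * z = of_int a" "nat b > 0" by simp_all
    then show ?thesis by (metis Ints_of_int)
  qed
  obtain i j k l :: nat where d: "i > 0" "of_nat i * A \<in> \<int>" "j > 0" "of_nat j * B \<in> \<int>"
    "k > 0" "of_nat k * C \<in> \<int>" "l > 0" "of_nat l * D \<in> \<int>"
    using den x by meson
  \<comment> \<open>The factor 2 undoes the halving in \<open>emb\<close>.\<close>
  define d where "d = 2 * (i * j * k * l)"
  have Z: "real (i * j * k * l) * A \<in> \<int>" "real (i * j * k * l) * B \<in> \<int>"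
    "real (i * j * k * l) * C \<in> \<int>" "real (i * j * k * l) * D \<in> \<int>"
  proof -
    have "real (i * j * k * l) * A = real (j * k * l) * (real i * A)"
      "real (i * j * k * l) * B = real (i * k * l) * (real j * B)"
      "real (i * j * k * l) * C = real (i * j * l) * (real k * C)"
      "real (i * j * k * l) * D = real (i * j * k) * (real l * D)" by simp_all
    then show "real (i * j * k * l) * A \<in> \<int>" "real (i * j * k * l) * B \<in> \<int>"
    "real (i * j * k * l) * C \<in> \<int>" "real (i * j * k * l) * D \<in> \<int>"
      using d by (metis Ints_mult Ints_of_nat)+
  qed
  then obtain a' b' c' d' where "real (i * j * k * l) * A = of_int a'" "real (i * j * k * l) * B = of_int b'"
    "real (i * j * k * l) * C = of_int c'" "real (i * j * k * l) * D = of_int d'"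
    by (elim Ints_cases)
  then have "ordq (2 * (real (i * j * k * l) * A), 2 * (real (i * j * k * l) * B),
      2 * (real (i * j * k * l) * C), 2 * (real (i * j * k * l) * D))" unfolding ordq_def by auto
  moreover have "emb 1 1 (2 * (real (i * j * k * l) * A), 2 * (real (i * j * k * l) * B),
      2 * (real (i * j * k * l) * C), 2 * (real (i * j * k * l) * D)) = of_nat d * y"
    unfolding x(5) d_def by (simp add: field_simps)
  ultimately have "of_nat d * y \<in> Ord" using OrdI by metis
  moreover have "d > 0" using d by (simp add: d_def)
  ultimately show ?thesis by blast
qed

text \<open>Algebraic integers of the field have powers with bounded denominators with respect to the order
  \<open>\<int>[\<surd>p, \<surd>q, \<surd>r]\<close>. Unlike integrality, this property is obviously closed under sums and products.\<close>

definition almost_int :: "real \<Rightarrow> bool" where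
  "almost_int y \<longleftrightarrow> (\<exists>d::nat. d > 0 \<and> (\<forall>k. of_nat d * y ^ k \<in> Ord))"

text \<open>\<open>d * d'\<close> clears the denominators of every term of the binomial
  expansion.\<close>

lemma almost_int_add: assumes "almost_int x" "almost_int y" shows "almost_int (x + y)"
proof -
  obtain d d' :: nat where d: "d > 0" "\<And>k. of_nat d * x ^ k \<in> Ord" "d' > 0" "\<And>k. of_nat d' * y ^ k \<in> Ord"
    using assms by (auto simp: almost_int_def)
  have "of_nat (d * d') * (x + y) ^ k \<in> Ord" for k
  proof -
    have "of_nat (d * d') * (x + y) ^ k
        = (\<Sum>i\<le>k. of_int (int (k choose i)) * ((of_nat d * x ^ i) * (of_nat d' * y ^ (k - i))))"
      by (simp add: binomial_ring sum_distrib_left mult_ac)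
    also have "\<dots> \<in> Ord" by (intro Ord_sum Ord_mult Ord_of_int d)
    finally show ?thesis .
  qed
  then show ?thesis using d unfolding almost_int_def by (intro exI[of _ "d * d'"]) auto
qed

lemma almost_int_mult: assumes "almost_int x" "almost_int y" shows "almost_int (x * y)"
proof -
  obtain d d' :: nat where d: "d > 0" "\<And>k. of_nat d * x ^ k \<in> Ord" "d' > 0" "\<And>k. of_nat d' * y ^ k \<in> Ord"
    using assms by (auto simp: almost_int_def)
  have "of_nat (d * d') * (x * y) ^ k \<in> Ord" for k
    using Ord_mult[OF d(2,4), of k k] by (simp add: power_mult_distrib mult_ac)
  then show ?thesis using d unfolding almost_int_def by (intro exI[of _ "d * d'"]) auto
qed

lemma almost_int_Rats: assumes "almost_int y" "y \<in> \<rat>" shows "y \<in> \<int>"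
proof -
  obtain d :: nat where "d > 0" "\<And>k. of_nat d * y ^ k \<in> Ord" using assms(1) by (auto simp: almost_int_def)
  then show ?thesis using assms(2) by (intro Ints_if_bounded_denominator[of y d] Ord_Rats) auto
qed

lemma KK_power: "y \<in> KK \<Longrightarrow> y ^ k \<in> KK"
  by (induction k) (auto intro: KK_mult Rats_KK)

text \<open>\<open>d\<close> clears the denominators of the powers below the degree; the monic
  equation expresses all higher powers through lower ones with the same \<open>d\<close>.\<close>

lemma algebraic_int_almost_int:
  assumes "algebraic_int y" "y \<in> KK" shows "almost_int y"
proof -
  obtain P where P: "lead_coeff P = 1" "\<And>i. coeff P i \<in> \<int>" "poly P y = 0"
    using assms(1) by (auto elim: algebraic_int.cases)
  define m where "m = degree P"
  have "(\<Sum>i\<le>m. coeff P i * y ^ i) = 0" using P(3) by (simp add: poly_altdef m_def)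
  then have ym: "y ^ m = - (\<Sum>i<m. coeff P i * y ^ i)"
    using P(1) by (simp add: m_def lessThan_Suc_atMost[symmetric] add_eq_0_iff)
  have "\<forall>i. \<exists>d::nat. d > 0 \<and> of_nat d * y ^ i \<in> Ord" using KK_denominator[OF KK_power[OF assms(2)]] by blast
  then obtain g :: "nat \<Rightarrow> nat" where g: "\<And>i. g i > 0" "\<And>i. of_nat (g i) * y ^ i \<in> Ord" by metis
  define d where "d = (\<Prod>i<m. g i)"
  have "of_nat d * y ^ k \<in> Ord" for k
  proof (induction k rule: less_induct)
    case (less k)
    show ?case
    proof (cases "k < m")
      case True
      then obtain t where "d = g k * t" unfolding d_def by (metis dvd_prodI finite_lessThan lessThan_iff dvdE)
      then have "of_nat d * y ^ k = of_int (int t) * (of_nat (g k) * y ^ k)" by simp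
      then show ?thesis using Ord_mult[OF Ord_of_int g(2)] by metis
    next
      case False
      then have "y ^ k = y ^ m * y ^ (k - m)" by (simp flip: power_add)
      then have "of_nat d * y ^ k = (\<Sum>i<m. (- coeff P i) * (of_nat d * y ^ (i + (k - m))))"
        by (simp add: ym sum_distrib_left sum_distrib_right power_add sum_negf mult_ac)
      also have "\<dots> \<in> Ord"
        using False by (intro Ord_sum Ord_mult Ord_Ints less.IH) (auto simp: P(2))
      finally show ?thesis .
    qed
  qed
  moreover have "d > 0" using g(1) by (simp add: d_def prod_pos)
  ultimately show ?thesis unfolding almost_int_def by blast
qed

fun powq :: "quad \<Rightarrow> nat \<Rightarrow> quad" where
  "powq x 0 = (2, 0, 0, 0)" | "powq x (Suc k) = mulq x (powq x k)"

lemma emb_powq: "e \<in> signs \<Longrightarrow> f \<in> signs \<Longrightarrow> emb e f (powq x k) = emb e f x ^ k"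
  by (induction k) (simp_all add: emb_mulq)

lemma ratq_powq: "ratq x \<Longrightarrow> ratq (powq x k)"
  by (induction k) (simp_all add: ratq_mulq ratq_iff)

text \<open>Conjugation maps the order to itself, so the same \<open>d\<close> serves.\<close>

lemma almost_int_conj:
  assumes x: "ratq x" and a: "almost_int (emb 1 1 x)" and e: "e \<in> signs" "f \<in> signs"
  shows "almost_int (emb e f x)"
proof -
  obtain d :: nat where d: "d > 0" "\<And>k. of_nat d * emb 1 1 x ^ k \<in> Ord" using a by (auto simp: almost_int_def)
  have "of_nat d * emb e f x ^ k \<in> Ord" for k
  proof -
    define z where "z = mulq (2 * of_nat d, 0, 0, 0) (powq x k)"
    have z: "ratq z" unfolding z_def by (intro ratq_mulq ratq_powq x) (simp add: ratq_iff)
    have ez: "emb e f z = of_nat d * emb e f x ^ k" if "e \<in> signs" "f \<in> signs" for e f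
      using that by (simp add: z_def emb_mulq emb_powq)
    obtain u where u: "ordq u" "of_nat d * emb 1 1 x ^ k = emb 1 1 u" using OrdE d(2) by blast
    have "z = u" by (rule emb_inj) (use z u ez one_signs ordq_ratq in auto)
    then have "ordq (cjq e f z)" using u(1) e by (cases z) (auto simp: ordq_def signs_def simp flip: of_int_minus)
    then have "emb 1 1 (cjq e f z) \<in> Ord" by (rule OrdI)
    then show ?thesis using ez[OF e] by (simp add: emb_cjq)
  qed
  then show ?thesis using d unfolding almost_int_def by blast
qed

text \<open>The trace \<open>2 * u\<close> and the norm \<open>u^2 - m * v^2\<close> are rational
  and almost integral, hence integers; \<open>squarefree_Ints\<close> then handles
  \<open>2 * v\<close>.\<close>

lemma quadratic_integers:
  fixes u v s :: real and m :: int
  assumes m: "squarefree m" "s * s = of_int m" and uv: "u \<in> \<rat>" "v \<in> \<rat>"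
    and a: "almost_int (u + v * s)" "almost_int (u - v * s)"
  shows "\<exists>U V :: int. 2 * u = of_int U \<and> 2 * v = of_int V \<and> 4 dvd U^2 - m * V^2"
proof -
  have "2 * u \<in> \<int>" using almost_int_add[OF a] almost_int_Rats[of "2 * u"] uv by simp
  then obtain U where U: "2 * u = of_int U" by (rule Ints_cases)
  have eq: "(u + v * s) * (u - v * s) = u^2 - of_int m * v^2"
    by (simp add: algebra_simps power2_eq_square flip: m(2))
  have "u^2 - of_int m * v^2 \<in> \<int>"
    using almost_int_mult[OF a] uv unfolding eq by (intro almost_int_Rats) auto
  then obtain w where w: "u^2 - of_int m * v^2 = of_int w" by (rule Ints_cases)
  have "of_int m * (2 * v)^2 = (2 * u)^2 - 4 * of_int w" using w by (simp add: power_mult_distrib)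
  then have mv: "of_int m * (2 * v)^2 = of_int (U^2 - 4 * w)" by (simp add: U)
  then have "2 * v \<in> \<int>" using squarefree_Ints[OF m(1), of "2 * v"] uv by simp
  then obtain V where V: "2 * v = of_int V" by (rule Ints_cases)
  have "of_int (m * V^2) = real_of_int (U^2 - 4 * w)" using mv unfolding V by simp
  then have "U^2 - m * V^2 = 4 * w" by (simp only: of_int_eq_iff)
  then show ?thesis using U V by auto
qed

end

locale biquadratic_sqfree = biquadratic +
  assumes sqfree: "squarefree ((2 * n - 1) * (2 * n + 1))" "squarefree ((2 * n - 1) * (2 * n + 3))"
    "squarefree ((2 * n + 1) * (2 * n + 3))"
begin

text \<open>Relative traces to the three quadratic subfields make \<open>A, B, C, D\<close>
  integers; the relative norm to the subfield of \<surd>q then forces the two parity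
  conditions.\<close>

lemma algebraic_int_intq:
  assumes x: "ratq x" and alg: "algebraic_int (emb 1 1 x)"
  shows "intq x"
proof -
  obtain A B C D where xA: "x = (A, B, C, D)" by (cases x)
  have Q: "A \<in> \<rat>" "B \<in> \<rat>" "C \<in> \<rat>" "D \<in> \<rat>" using x by (auto simp: xA ratq_iff)
  have a: "almost_int (emb e f x)" if "e \<in> signs" "f \<in> signs" for e f
    using almost_int_conj[OF x algebraic_int_almost_int[OF alg KK_I[OF x]] that] .
  note a4 = a[OF one_signs(1) one_signs(1)] a[OF one_signs(1) one_signs(2)]
    a[OF one_signs(2) one_signs(1)] a[OF one_signs(2) one_signs(2)]
  note sums = almost_int_add[OF a4(1,2)] almost_int_add[OF a4(3,4)] almost_int_add[OF a4(1,3)]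
    almost_int_add[OF a4(2,4)] almost_int_add[OF a4(1,4)] almost_int_add[OF a4(2,3)]
  have ss: "sp * sp = of_int ((2 * n - 1) * (2 * n + 1))" "sq * sq = of_int ((2 * n - 1) * (2 * n + 3))"
    "sr * sr = of_int ((2 * n + 1) * (2 * n + 3))"
    by (simp_all add: s_products ra_def rb_def rc_def)
  obtain U V where 1: "2 * A = of_int U" "2 * B = of_int V" "4 dvd U^2 - (2 * n - 1) * (2 * n + 1) * V^2"
    using quadratic_integers[OF sqfree(1) ss(1) Q(1,2)] sums(1,2) by (auto simp: xA algebra_simps add_divide_distrib diff_divide_distrib)
  obtain U' W where 2: "2 * A = of_int U'" "2 * C = of_int W" "4 dvd U'^2 - (2 * n - 1) * (2 * n + 3) * W^2"
    using quadratic_integers[OF sqfree(2) ss(2) Q(1,3)] sums(3,4) by (auto simp: xA algebra_simps add_divide_distrib diff_divide_distrib)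
  obtain U'' Z where 3: "2 * A = of_int U''" "2 * D = of_int Z" "4 dvd U''^2 - (2 * n + 1) * (2 * n + 3) * Z^2"
    using quadratic_integers[OF sqfree(3) ss(3) Q(1,4)] sums(5,6) by (auto simp: xA algebra_simps add_divide_distrib diff_divide_distrib)
  \<comment> \<open>Modulo 4 the coefficient p is -1; below, q is 1 and r is -1.\<close>
  have "U^2 + V^2 = (U^2 - (2 * n - 1) * (2 * n + 1) * V^2) + 4 * (n^2 * V^2)"
    by (simp add: algebra_simps power2_eq_square)
  then have "4 dvd U^2 + V^2" using 1(3) by (metis dvd_add dvd_triv_left)
  then have e1: "even U" "even V" using sum_squares_4_dvd[of U V] by auto
  have "U'^2 - W^2 = (U'^2 - (2 * n - 1) * (2 * n + 3) * W^2) + 4 * ((n^2 + n - 1) * W^2)"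
    by (simp add: algebra_simps power2_eq_square)
  then have "4 dvd U'^2 - W^2" using 2(3) by (metis dvd_add dvd_triv_left)
  then have e2: "even U' \<longleftrightarrow> even W" by (rule diff_squares_4_dvd)
  have "U''^2 + Z^2 = (U''^2 - (2 * n + 1) * (2 * n + 3) * Z^2) + 4 * ((n + 1)^2 * Z^2)"
    by (simp add: algebra_simps power2_eq_square)
  then have "4 dvd U''^2 + Z^2" using 3(3) by (metis dvd_add dvd_triv_left)
  then have e3: "even Z" using sum_squares_4_dvd[of U'' Z] by auto
  have "U' = U" using 1(1) 2(1) by simp
  then have "even W" using e1 e2 by simp
  then obtain A' B' C' D' where i: "U = 2 * A'" "V = 2 * B'" "W = 2 * C'" "Z = 2 * D'" using e1 e3 by (auto elim!: evenE)
  then have I: "A = of_int A'" "B = of_int B'" "C = of_int C'" "D = of_int D'" using 1 2 3 by simp_all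
  \<comment> \<open>\<open>u + v * sq\<close> is the product of \<open>x\<close> with its conjugate
    over the subfield of \<surd>q.\<close>
  define u where "u = (A^2 - ra * rb * B^2 + ra * rc * C^2 - rb * rc * D^2) / 4"
  define v where "v = (A * C - rb * B * D) / 2"
  have uv: "u \<in> \<rat>" "v \<in> \<rat>" using Q r_Rats by (auto simp: u_def v_def)
  have "emb 1 1 x * emb (-1) 1 x = u + v * sq" "emb 1 (-1) x * emb (-1) (-1) x = u - v * sq"
    by (simp_all add: xA u_def v_def sp_def sq_def sr_def s_sq[symmetric] power2_eq_square field_simps)
  then have "almost_int (u + v * sq)" "almost_int (u - v * sq)"
    using almost_int_mult[OF a4(1,3)] almost_int_mult[OF a4(2,4)] by simp_all
  then obtain P R where PR: "2 * u = of_int P" "2 * v = of_int R" "4 dvd P^2 - (2 * n - 1) * (2 * n + 3) * R^2"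
    using quadratic_integers[OF sqfree(2) ss(2) uv] by blast
  have "P^2 - R^2 = (P^2 - (2 * n - 1) * (2 * n + 3) * R^2) + 4 * ((n^2 + n - 1) * R^2)"
    by (simp add: algebra_simps power2_eq_square)
  then have "4 dvd P^2 - R^2" using PR(3) by (metis dvd_add dvd_triv_left)
  then have "even P \<longleftrightarrow> even R" by (rule diff_squares_4_dvd)
  then have PR4: "4 dvd 2 * P - 2 * R" by presburger
  have "real_of_int (2 * P) = of_int (A'^2 - (2*n-1)*(2*n+1) * B'^2 + (2*n-1)*(2*n+3) * C'^2 - (2*n+1)*(2*n+3) * D'^2)"
    using PR(1) by (simp add: u_def I ra_def rb_def rc_def)
  then have P: "2 * P = A'^2 - (2*n-1)*(2*n+1) * B'^2 + (2*n-1)*(2*n+3) * C'^2 - (2*n+1)*(2*n+3) * D'^2"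
    by (simp only: of_int_eq_iff)
  have "real_of_int R = of_int (A' * C' - (2*n+1) * B' * D')"
    using PR(2) by (simp add: v_def I rb_def)
  then have R: "R = A' * C' - (2*n+1) * B' * D'" by (simp only: of_int_eq_iff)
  have "2 * P - 2 * R = ((A' - C')^2 + (B' + D')^2) + 4 * ((n^2 + n - 1) * C'^2 - n^2 * B'^2 - (n + 1)^2 * D'^2 + n * B' * D')"
    unfolding P R by (simp add: algebra_simps power2_eq_square)
  then have "4 dvd (A' - C')^2 + (B' + D')^2" using PR4 by (simp add: dvd_add_left_iff)
  then have "even (A' - C')" "even (B' - D')" using sum_squares_4_dvd by fastforce+
  then show ?thesis unfolding xA I by (rule intqI)
qed

text \<open>\<open>y\<close> satisfies a quadratic equation over the subfield of \<surd>q; moving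
  the multiples of \<surd>q to one side and squaring gives a monic quartic over the
  integers.\<close>

lemma intq_algebraic_int:
  assumes "intq x" shows "algebraic_int (emb 1 1 x)"
proof -
  obtain A B C D :: int where x: "x = (of_int A, of_int B, of_int C, of_int D)" and e: "even (A - C)" "even (B - D)"
    using assms by (auto simp: intq_def)
  obtain k where k: "A = C + 2 * k" using e(1) by (metis dvd_def add.commute diff_add_cancel)
  obtain l where l: "B = D + 2 * l" using e(2) by (metis dvd_def add.commute diff_add_cancel)
  define P where "P = (2*n^2 + 2*n - 1) * C^2 + 2 * C * k + 2 * k^2 - (4*n^2+4*n+1) * D^2 - (4*n^2-1) * (2 * D * l + 2 * l^2)"
  define R where "R = C^2 + 2 * C * k - (2*n+1) * (D^2 + 2 * D * l)"
  define q where "q = (2*n-1) * (2*n+3)"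
  have P: "2 * P = A^2 - (2*n-1)*(2*n+1) * B^2 + q * C^2 - (2*n+1)*(2*n+3) * D^2"
    and R: "R = A * C - (2*n+1) * B * D"
    unfolding P_def R_def q_def k l by (simp_all add: algebra_simps power2_eq_square)
  have "even (P - R)"
  proof -
    have "P - R = 2 * ((n^2 + n - 1) * C^2 + k^2 - (2*n^2 + n) * D^2 - (4*n^2-1) * l^2
      + (2*n + 2 - 4*n^2) * D * l)" unfolding P_def R_def by (simp add: algebra_simps power2_eq_square)
    then show ?thesis by simp
  qed
  then obtain h where h: "P = R + 2 * h" by (metis dvd_def add.commute diff_add_cancel)
  \<comment> \<open>The norm of \<open>y\<close>; it is an integer because \<open>P\<close> and
    \<open>R\<close> have the same parity.\<close>
  define S where "S = R * h + h^2 - (n^2 + n - 1) * R^2"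
  have S: "4 * S = P^2 - q * R^2" unfolding S_def h q_def by (simp add: algebra_simps power2_eq_square)
  define y where "y = emb 1 1 x"
  define u v where "u = real_of_int P / 2" and "v = real_of_int R / 2"
  have yy: "y^2 - A * y + u = sq * (C * y - v)"
  proof -
    have P': "2 * u = (real_of_int (2 * P)) / 2" by (simp add: u_def)
    have u: "u = (A^2 - ra * rb * B^2 + ra * rc * C^2 - rb * rc * D^2) / 4"
      using P' unfolding P q_def by (simp add: ra_def rb_def rc_def)
    have v: "v = (A * C - rb * B * D) / 2" by (simp add: v_def R rb_def)
    show ?thesis unfolding u v y_def x
      by (simp add: sp_def sq_def sr_def s_sq[symmetric] power2_eq_square field_simps)
  qed
  have "(y^2 - A * y + u)^2 = of_int q * (C * y - v)^2"
    unfolding yy power_mult_distrib by (simp add: power2_eq_square s_products q_def ra_def rc_def)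
  then have root: "y^4 - 2 * A * y^3 + (A^2 + 2 * u - q * C^2) * y^2 + (2 * q * C * v - 2 * A * u) * y + (u^2 - q * v^2) = 0"
    by (simp add: algebra_simps power2_eq_square power3_eq_cube power4_eq_xxxx)
  have "u^2 - q * v^2 = of_int S"
    using arg_cong[OF S, of real_of_int] by (simp add: u_def v_def power2_eq_square field_simps)
  then have root': "y^4 - of_int (2 * A) * y^3 + of_int (A^2 + P - q * C^2) * y^2 + of_int (q * C * R - A * P) * y + of_int S = 0"
    using root by (simp add: u_def v_def mult.assoc)
  show ?thesis
    by (rule algebraic_int.intros[of "[:of_int S, of_int (q * C * R - A * P), of_int (A^2 + P - q * C^2), - of_int (2 * A), 1:]"])
       (use root' in \<open>auto simp: coeff_pCons y_def[symmetric] power2_eq_square power3_eq_cube power4_eq_xxxx algebra_simps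
          split: nat.splits\<close>)
qed


lemma ring_of_integers_emb: "ratq x \<Longrightarrow> emb 1 1 x \<in> ring_of_integers KK \<longleftrightarrow> intq x"
  using algebraic_int_intq intq_algebraic_int KK_I unfolding ring_of_integers_def by blast

lemma ring_of_integersE: "y \<in> ring_of_integers KK \<Longrightarrow> \<exists>x. intq x \<and> y = emb 1 1 x"
  using KK_E[of y] ring_of_integers_emb unfolding ring_of_integers_def by blast

lemma pos_integers_emb: "intq x \<Longrightarrow> emb 1 1 x \<in> pos_integers KK \<longleftrightarrow> posq x"
  using ring_of_integers_emb totally_positive_emb intq_ratq unfolding pos_integers_def by blast

section \<open>Trace pairing with the codifferent\<close>

definition unit_w :: quad where "unit_w = (rb, - 1, - 1, 1)"
definition unit_w_inv :: quad where "unit_w_inv = (- rb, - 1, 1, 1)"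

lemma intq_w: "intq unit_w" "intq unit_w_inv"
  using intqI[of "2 * n + 1" "- 1" "- 1" 1] intqI[of "- (2 * n + 1)" 1 "- 1" 1]
  by (simp_all add: unit_w_def unit_w_inv_def rb_def)

lemma mulq_w: "mulq unit_w unit_w_inv = (2, 0, 0, 0)"
  by (simp add: unit_w_def unit_w_inv_def ra_def rb_def rc_def field_simps)

lemma twisted_pos_w: "twisted_pos unit_w" "twisted_pos unit_w_inv"
proof -
  have s: "0 < sa" "sa < sb" "sb < sc" by (rule s_pos)+
  \<comment> \<open>The unit is \<open>(sb - sa) * (sc + sb) / 2\<close> and its inverse
    \<open>(sb + sa) * (sc - sb) / 2\<close>; the four products are these factors with the signs
    changed.\<close>
  have 1: "(sb - sa) * (sc + sb) > 0" "(sb + sa) * (sc + sb) > 0" "(sc - sb) * (sb + sa) > 0" "(sc - sb) * (sb - sa) > 0"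
    using s by simp_all
  show "twisted_pos unit_w" "twisted_pos unit_w_inv" unfolding unit_w_def unit_w_inv_def twisted_pos_iff
    using 1 by (simp_all add: sp_def sq_def sr_def s_sq[symmetric] algebra_simps)
qed

lemma twisted_pos_twisted_pos_posq: "twisted_pos x \<Longrightarrow> twisted_pos y \<Longrightarrow> posq (mulq x y)"
proof -
  assume t: "twisted_pos x" "twisted_pos y"
  have "0 < emb e f (mulq x y)" if ef: "e \<in> signs" "f \<in> signs" for e f
  proof -
    have "0 < (e * f * emb e f x) * (e * f * emb e f y)"
      by (rule mult_pos_pos) (use t ef in \<open>auto simp: twisted_pos_def\<close>)
    also have "\<dots> = emb e f (mulq x y)" using ef by (auto simp: emb_mulq signs_def)
    finally show ?thesis .
  qed
  then show ?thesis by (simp add: posq_def)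
qed

text \<open>This quadruple represents \<open>1 / (2 \<surd>r)\<close>.\<close>

definition inv_sr :: quad where "inv_sr = (0, 0, 0, 1 / (rb * rc))"

lemma inv_sr_props: "ratq inv_sr" "twisted_pos inv_sr" "fst (mulq z inv_sr) = height z / 2"
proof -
  show "ratq inv_sr" by (simp add: inv_sr_def ratq_iff r_Rats)
  show "twisted_pos inv_sr" using s_pos r_pos by (simp add: inv_sr_def twisted_pos_iff sr_def)
  show "fst (mulq z inv_sr) = height z / 2" using r_pos by (cases z) (simp add: inv_sr_def)
qed

lemma trace_emb_mult:
  assumes "ratq x" "ratq y"
  shows "real_of_rat (field_trace KK (emb 1 1 x * emb 1 1 y)) = 2 * fst (mulq x y)"
  using field_trace_emb[OF ratq_mulq[OF assms]] by (simp add: emb_mulq one_signs)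

lemma trace_codifferent:
  assumes "intq m" "intq x"
  shows "real_of_rat (field_trace KK (emb 1 1 x * emb 1 1 (mulq m inv_sr))) = height (mulq m x)"
proof -
  have "mulq x (mulq m inv_sr) = mulq (mulq m x) inv_sr" by (metis mulq_assoc mulq_comm)
  then show ?thesis
    using trace_emb_mult[of x "mulq m inv_sr"] assms by (simp add: intq_ratq ratq_mulq inv_sr_props(1) inv_sr_props(3))
qed

text \<open>The trace against an integer \<open>x\<close> is the height of \<open>m x\<close>, an
  integer; positivity holds because both factors have the signs of \<surd>r.\<close>

lemma codifferentI:
  assumes m: "intq m" "twisted_pos m"
  shows "emb 1 1 (mulq m inv_sr) \<in> pos_codifferent KK"
proof -
  have r: "ratq (mulq m inv_sr)" using m by (simp add: intq_ratq ratq_mulq inv_sr_props(1))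
  have "field_trace KK (y * emb 1 1 (mulq m inv_sr)) \<in> \<int>" if y: "y \<in> ring_of_integers KK" for y
  proof -
    obtain x where x: "intq x" "y = emb 1 1 x" using ring_of_integersE[OF y] by blast
    obtain k :: int where "height (mulq m x) = k" using height_int[OF intq_mulq[OF m(1) x(1)]] by blast
    then have "real_of_rat (field_trace KK (y * emb 1 1 (mulq m inv_sr))) = real_of_rat (of_int k)"
      using trace_codifferent[OF m(1) x(1)] x(2) by simp
    then show ?thesis by (simp only: of_rat_eq_iff Ints_of_int)
  qed
  moreover have "totally_positive KK (emb 1 1 (mulq m inv_sr))"
    using totally_positive_emb[OF r] twisted_pos_twisted_pos_posq[OF m(2) inv_sr_props(2)] by simp
  ultimately show ?thesis using KK_I[OF r] by (simp add: pos_codifferent_def codifferent_def)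
qed

text \<open>Traces in the pairing are natural numbers, which makes the minimum in the theorem
  attained.\<close>

lemma trace_pos_int:
  assumes "\<alpha> \<in> pos_integers KK" "\<delta> \<in> pos_codifferent KK"
  shows "\<exists>k::nat. field_trace KK (\<alpha> * \<delta>) = of_nat k"
proof -
  obtain x where x: "intq x" "\<alpha> = emb 1 1 x" using assms(1) ring_of_integersE unfolding pos_integers_def by blast
  obtain z where z: "ratq z" "\<delta> = emb 1 1 z"
    using assms(2) KK_E unfolding pos_codifferent_def codifferent_def by blast
  have p: "posq x" "posq z"
    using assms x z pos_integers_emb totally_positive_emb unfolding pos_codifferent_def by blast+
  have "posq (mulq x z)" using p by (rule posq_mulq)
  then have "0 < 2 * fst (mulq x z)"
    by (cases "mulq x z") (simp add: posq_def signs_def)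
  then have "0 < real_of_rat (field_trace KK (\<alpha> * \<delta>))"
    using trace_emb_mult[OF intq_ratq[OF x(1)] z(1)] x z by simp
  then have "0 < field_trace KK (\<alpha> * \<delta>)" by simp
  moreover have "field_trace KK (\<alpha> * \<delta>) \<in> \<int>"
    using assms unfolding pos_codifferent_def codifferent_def pos_integers_def by blast
  ultimately show ?thesis by (metis Ints_cases of_int_0_less_iff of_int_of_nat_eq zero_less_imp_eq_int)
qed

text \<open>For \<open>y = w \<alpha>\<close>, a splitting of \<open>y\<close> would decompose
  \<alpha> after multiplication by the inverse of w, so reducibility provides \<open>m\<close>; then
  \<delta> = m w / (2 \<surd>r) has trace at most 2.\<close>

lemma indecomposable_trace_le_2:
  assumes "indecomposable KK \<alpha>"
  shows "\<exists>\<delta>\<in>pos_codifferent KK. field_trace KK (\<alpha> * \<delta>) \<le> 2"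
proof -
  have a: "\<alpha> \<in> pos_integers KK" using assms by (simp add: indecomposable_def)
  obtain x where x: "intq x" "\<alpha> = emb 1 1 x" using a ring_of_integersE unfolding pos_integers_def by blast
  have px: "posq x" using a x pos_integers_emb by blast
  define y where "y = mulq x unit_w"
  have y: "intq y" "twisted_pos y" using x px intq_w twisted_pos_w by (auto simp: y_def intro: intq_mulq twisted_pos_mulq)
  have xy: "x = mulq unit_w_inv y" unfolding y_def by (metis mulq_assoc mulq_comm mulq_one mulq_w)
  have "\<not> splits y"
  proof
    assume "splits y"
    then obtain u v where uv: "intq u" "intq v" "twisted_pos u" "twisted_pos v" "y = u + v" unfolding splits_def by blast
    have "emb 1 1 (mulq unit_w_inv u) \<in> pos_integers KK" "emb 1 1 (mulq unit_w_inv v) \<in> pos_integers KK"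
      using uv intq_w twisted_pos_w twisted_pos_twisted_pos_posq pos_integers_emb intq_mulq by blast+
    moreover have "\<alpha> = emb 1 1 (mulq unit_w_inv u) + emb 1 1 (mulq unit_w_inv v)"
      unfolding x(2) xy uv(5) mulq_add emb_add ..
    ultimately show False using assms unfolding indecomposable_def by blast
  qed
  then obtain m where m: "intq m" "posq m" "height (mulq m y) \<le> 2"
    using twisted_pos_reducible[OF y] unfolding reducible_def by blast
  have mw: "intq (mulq m unit_w)" "twisted_pos (mulq m unit_w)" using m intq_w twisted_pos_w by (auto intro: intq_mulq twisted_pos_mulq)
  have "mulq (mulq m unit_w) x = mulq m y" unfolding y_def by (metis mulq_assoc mulq_comm)
  then have "real_of_rat (field_trace KK (\<alpha> * emb 1 1 (mulq (mulq m unit_w) inv_sr))) \<le> real_of_rat 2"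
    using trace_codifferent[OF mw(1) x(1)] m(3) x(2) by simp
  then have "field_trace KK (\<alpha> * emb 1 1 (mulq (mulq m unit_w) inv_sr)) \<le> 2" by (simp only: of_rat_less_eq)
  then show ?thesis using codifferentI[OF mw] by blast
qed

end

theorem theorem1p4:
  fixes n p q r :: int and K :: "real set" and \<alpha> :: real
  assumes "n \<ge> 6"
    and "p = (2 * n - 1) * (2 * n + 1)"
    and "q = (2 * n - 1) * (2 * n + 3)"
    and "r = (2 * n + 1) * (2 * n + 3)"
    and "squarefree p" and "squarefree q" and "squarefree r"
    and "K = rat_adjoin {sqrt (of_int p), sqrt (of_int q)}"
    and "\<alpha> \<in> pos_integers K"
    and "indecomposable K \<alpha>"
  shows "\<exists>\<delta>\<^sub>0\<in>pos_codifferent K.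
           (\<forall>\<delta>\<in>pos_codifferent K. field_trace K (\<alpha> * \<delta>\<^sub>0) \<le> field_trace K (\<alpha> * \<delta>)) \<and>
           field_trace K (\<alpha> * \<delta>\<^sub>0) \<le> 2"
proof -
  interpret biquadratic_sqfree n using assms by unfold_locales auto
  have "sqrt (of_int p) = sp" "sqrt (of_int q) = sq"
    by (simp_all add: assms(2,3) sp_def sq_def sa_def sb_def sc_def ra_def rb_def rc_def real_sqrt_mult)
  then have K: "K = KK" using assms(8) rat_adjoin_KK by simp
  obtain \<delta>\<^sub>1 where \<delta>1: "\<delta>\<^sub>1 \<in> pos_codifferent K" "field_trace K (\<alpha> * \<delta>\<^sub>1) \<le> 2"
    using indecomposable_trace_le_2 assms(10) K by blast
  \<comment> \<open>The attained traces form a nonempty set of natural numbers; its least element is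
    the minimum.\<close>
  define T where "T k \<longleftrightarrow> (\<exists>\<delta>\<in>pos_codifferent K. field_trace K (\<alpha> * \<delta>) = of_nat k)" for k :: nat
  have T: "\<exists>k. T k \<and> field_trace K (\<alpha> * \<delta>) = of_nat k" if "\<delta> \<in> pos_codifferent K" for \<delta>
    using trace_pos_int[of \<alpha> \<delta>] that assms(9) unfolding T_def K by blast
  have "T (LEAST k. T k)" using T[OF \<delta>1(1)] LeastI by blast
  then obtain \<delta>\<^sub>0 where \<delta>0: "\<delta>\<^sub>0 \<in> pos_codifferent K" "field_trace K (\<alpha> * \<delta>\<^sub>0) = of_nat (LEAST k. T k)"
    unfolding T_def by blast
  have min: "field_trace K (\<alpha> * \<delta>\<^sub>0) \<le> field_trace K (\<alpha> * \<delta>)" if "\<delta> \<in> pos_codifferent K" for \<delta>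
    using T[OF that] Least_le[of T] \<delta>0(2) by auto
  show ?thesis using \<delta>0(1) min min[OF \<delta>1(1)] \<delta>1(2) by (intro bexI[of _ \<delta>\<^sub>0]) auto
qed

end
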